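(* Let $L\in\mathcal{L}$ be such that $L$ and $L^*$ have order continuous norms. Let $\{A_{ij}\}_{i=1,\dots,k;\ j=1,\dots,m}$ be nonnegative matrices that define operators on $L$ and let $\alpha_1,\dots,\alpha_m$ be positive numbers with $\sum_{j=1}^m\alpha_j\ge1$. Put $$A=\left(A_{11}^{(\alpha_1)}\circ\cdots\circ A_{1m}^{(\alpha_m)}\right)\cdots\left(A_{k1}^{(\alpha_1)}\circ\cdots\circ A_{km}^{(\alpha_m)}\right).$$ Then $$\gamma(A)\le\gamma\left((A_{11}\cdots A_{k1})^{(\alpha_1)}\circ\cdots\circ(A_{1m}\cdots A_{km})^{(\alpha_m)}\right)\le\gamma(A_{11}\cdots A_{k1})^{\alpha_1}\cdots\gamma(A_{1m}\cdots A_{km})^{\alpha_m}$$ and $$\rho_{ess}(A)\le\rho_{ess}\left((A_{11}\cdots A_{k1})^{(\alpha_1)}\circ\cdots\circ(A_{1m}\cdots A_{km})^{(\alpha_m)}\right)\le\rho_{ess}(A_{11}\cdots A_{k1})^{\alpha_1}\cdots\rho_{ess}(A_{1m}\cdots A_{km})^{\alpha_m}.$$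
   Context: Let $R=\mathbb{N}$ or $R=\{1,\dots,N\}$. A Banach sequence space is a Banach space $L$ of complex sequences indexed by $R$ such that if $x$ is a complex sequence, $y\in L$ and $|x|\le|y|$ entrywise, then $x\in L$ and $\|x\|_L\le\|y\|_L$. $\mathcal{L}$ is the class of Banach sequence spaces containing every standard unit vector $e_n$ with $\|e_n\|_L=1$. A Banach lattice has order continuous norm if every decreasing net $0\le f_\alpha\downarrow0$ satisfies $\|f_\alpha\|\to0$; $L^*$ is the Banach dual of $L$. A nonnegative matrix $A=[a_{ij}]_{i,j\in R}$ defines an operator on $L$ if for every $x\in L$ the sums $(Ax)_i=\sum_j a_{ij}x_j$ converge absolutely and $Ax\in L$. Hadamard power: $A^{(t)}=[a_{ij}^t]$; Hadamard product: $A\circ B=[a_{ij}b_{ij}]$; matrix products are ordinary products. (It is known that for $\sum\alpha_j\ge1$ all matrices above define operators on $L$.) $\gamma(T)=\inf\{\delta>0: T(D_L)\subseteq M+\delta D_L\text{ for some finite }M\subset L\}$ is the Hausdorff measure of noncompactness ($D_L$ the closed unit ball), and $\rho_{ess}(T)$ is the essential spectral radius (spectral radius of the image of $T$ in the Calkin algebra). *)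

theory Defs
  imports Complex_Main
begin

type_synonym cseq = "nat \<Rightarrow> complex"
type_synonym rmat = "nat \<Rightarrow> nat \<Rightarrow> real"

text \<open>Index set R: either all of nat (playing the role of N) or {1..N}.\<close>
definition index_set :: "nat set \<Rightarrow> bool" where
  "index_set R \<longleftrightarrow> R = UNIV \<or> (\<exists>N\<ge>1. R = {1..N})"

definition unitvec :: "nat \<Rightarrow> cseq" where
  "unitvec n = (\<lambda>i. if i = n then 1 else 0)"

definition banach_seq_space :: "nat set \<Rightarrow> cseq set \<Rightarrow> (cseq \<Rightarrow> real) \<Rightarrow> bool" where
  "banach_seq_space R L nL \<longleftrightarrow>
     index_set R \<and>
     (\<forall>x\<in>L. \<forall>n. n \<notin> R \<longrightarrow> x n = 0) \<and>
     (\<lambda>n. 0) \<in> L \<and>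
     (\<forall>x\<in>L. \<forall>y\<in>L. (\<lambda>n. x n + y n) \<in> L) \<and>
     (\<forall>x\<in>L. \<forall>c. (\<lambda>n. c * x n) \<in> L) \<and>
     (\<forall>x\<in>L. nL x = 0 \<longleftrightarrow> x = (\<lambda>n. 0)) \<and>
     (\<forall>x\<in>L. 0 \<le> nL x) \<and>
     (\<forall>x\<in>L. \<forall>c. nL (\<lambda>n. c * x n) = cmod c * nL x) \<and>
     (\<forall>x\<in>L. \<forall>y\<in>L. nL (\<lambda>n. x n + y n) \<le> nL x + nL y) \<and>
     (\<forall>f. (\<forall>n. f n \<in> L) \<and>
          (\<forall>e>0. \<exists>N. \<forall>p\<ge>N. \<forall>q\<ge>N. nL (\<lambda>i. f p i - f q i) < e) \<longrightarrow>
          (\<exists>y\<in>L. (\<lambda>n. nL (\<lambda>i. f n i - y i)) \<longlonglongrightarrow> 0)) \<and>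
     (\<forall>x y. y \<in> L \<and> (\<forall>n. cmod (x n) \<le> cmod (y n)) \<longrightarrow> x \<in> L \<and> nL x \<le> nL y)"

definition in_class_L :: "nat set \<Rightarrow> cseq set \<Rightarrow> (cseq \<Rightarrow> real) \<Rightarrow> bool" where
  "in_class_L R L nL \<longleftrightarrow> banach_seq_space R L nL \<and>
     (\<forall>n\<in>R. unitvec n \<in> L \<and> nL (unitvec n) = 1)"

text \<open>Order continuity of the norm of a (complex) Banach lattice with carrier C, positivity
  predicate pos, norm nrm, subtraction sub and zero z: every nonempty downward directed set D
  of positive elements with infimum 0 (i.e. the only positive lower bound is 0) has
  inf of norms 0. This is exactly the condition "every decreasing net 0 \<le> f_a \<down> 0
  has norms tending to 0" (a decreasing net is its own directed image set).\<close>
definition order_cont_norm ::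
  "'a set \<Rightarrow> ('a \<Rightarrow> bool) \<Rightarrow> ('a \<Rightarrow> real) \<Rightarrow> ('a \<Rightarrow> 'a \<Rightarrow> 'a) \<Rightarrow> 'a \<Rightarrow> bool" where
  "order_cont_norm C pos nrm sub z \<longleftrightarrow>
     (\<forall>D. D \<subseteq> C \<and> D \<noteq> {} \<and> (\<forall>f\<in>D. pos f) \<and>
          (\<forall>f\<in>D. \<forall>g\<in>D. \<exists>h\<in>D. pos (sub f h) \<and> pos (sub g h)) \<and>
          (\<forall>h\<in>C. pos h \<and> (\<forall>f\<in>D. pos (sub f h)) \<longrightarrow> h = z)
      \<longrightarrow> (\<forall>e>0. \<exists>f\<in>D. nrm f < e))"

definition seq_pos :: "cseq \<Rightarrow> bool" where
  "seq_pos x \<longleftrightarrow> (\<forall>n. Im (x n) = 0 \<and> 0 \<le> Re (x n))"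

definition seq_sub :: "cseq \<Rightarrow> cseq \<Rightarrow> cseq" where
  "seq_sub x y = (\<lambda>n. x n - y n)"

definition Ldual :: "cseq set \<Rightarrow> (cseq \<Rightarrow> real) \<Rightarrow> (cseq \<Rightarrow> complex) set" where
  "Ldual L nL = {phi.
     (\<forall>x\<in>L. \<forall>y\<in>L. phi (\<lambda>n. x n + y n) = phi x + phi y) \<and>
     (\<forall>x\<in>L. \<forall>c. phi (\<lambda>n. c * x n) = c * phi x) \<and>
     (\<exists>K. \<forall>x\<in>L. cmod (phi x) \<le> K * nL x) \<and>
     (\<forall>x. x \<notin> L \<longrightarrow> phi x = 0)}"

definition dual_norm :: "cseq set \<Rightarrow> (cseq \<Rightarrow> real) \<Rightarrow> (cseq \<Rightarrow> complex) \<Rightarrow> real" where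
  "dual_norm L nL phi = Sup {cmod (phi x) | x. x \<in> L \<and> nL x \<le> 1}"

definition dual_pos :: "cseq set \<Rightarrow> (cseq \<Rightarrow> complex) \<Rightarrow> bool" where
  "dual_pos L phi \<longleftrightarrow> (\<forall>x\<in>L. seq_pos x \<longrightarrow> Im (phi x) = 0 \<and> 0 \<le> Re (phi x))"

definition dual_sub :: "(cseq \<Rightarrow> complex) \<Rightarrow> (cseq \<Rightarrow> complex) \<Rightarrow> (cseq \<Rightarrow> complex)" where
  "dual_sub phi psi = (\<lambda>x. phi x - psi x)"

definition matop :: "nat set \<Rightarrow> rmat \<Rightarrow> cseq \<Rightarrow> cseq" where
  "matop R a x = (\<lambda>i. if i \<in> R then (\<Sum>j. if j \<in> R then complex_of_real (a i j) * x j else 0) else 0)"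

definition defines_operator :: "nat set \<Rightarrow> cseq set \<Rightarrow> rmat \<Rightarrow> bool" where
  "defines_operator R L a \<longleftrightarrow>
     (\<forall>x\<in>L. (\<forall>i\<in>R. summable (\<lambda>j. if j \<in> R then cmod (complex_of_real (a i j) * x j) else 0))
            \<and> matop R a x \<in> L)"

definition matmul :: "nat set \<Rightarrow> rmat \<Rightarrow> rmat \<Rightarrow> rmat" where
  "matmul R a b = (\<lambda>i j. if i \<in> R \<and> j \<in> R then (\<Sum>l. if l \<in> R then a i l * b l j else 0) else 0)"

definition idmat :: "nat set \<Rightarrow> rmat" where
  "idmat R = (\<lambda>i j. if i \<in> R \<and> i = j then 1 else 0)"

fun matprods :: "nat set \<Rightarrow> (nat \<Rightarrow> rmat) \<Rightarrow> nat \<Rightarrow> rmat" where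
  "matprods R F 0 = idmat R"
| "matprods R F (Suc k) = matmul R (matprods R F k) (F (Suc k))"

definition hpow :: "rmat \<Rightarrow> real \<Rightarrow> rmat" where
  "hpow a t = (\<lambda>i j. a i j powr t)"

definition hprods :: "(nat \<Rightarrow> rmat) \<Rightarrow> nat \<Rightarrow> rmat" where
  "hprods G m = (\<lambda>i j. \<Prod>l\<in>{1..m}. G l i j)"

definition hmnc :: "cseq set \<Rightarrow> (cseq \<Rightarrow> real) \<Rightarrow> (cseq \<Rightarrow> cseq) \<Rightarrow> real" where
  "hmnc L nL T = Inf {d. d > 0 \<and> (\<exists>M. finite M \<and> M \<subseteq> L \<and>
       (\<forall>x\<in>L. nL x \<le> 1 \<longrightarrow> (\<exists>y\<in>M. nL (\<lambda>i. T x i - y i) \<le> d)))}"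

definition bounded_op :: "cseq set \<Rightarrow> (cseq \<Rightarrow> real) \<Rightarrow> (cseq \<Rightarrow> cseq) \<Rightarrow> bool" where
  "bounded_op L nL S \<longleftrightarrow> (\<forall>x\<in>L. S x \<in> L) \<and>
     (\<forall>x\<in>L. \<forall>y\<in>L. S (\<lambda>n. x n + y n) = (\<lambda>n. S x n + S y n)) \<and>
     (\<forall>x\<in>L. \<forall>c. S (\<lambda>n. c * x n) = (\<lambda>n. c * S x n)) \<and>
     (\<exists>K. \<forall>x\<in>L. nL (S x) \<le> K * nL x)"

definition compact_op :: "cseq set \<Rightarrow> (cseq \<Rightarrow> real) \<Rightarrow> (cseq \<Rightarrow> cseq) \<Rightarrow> bool" where
  "compact_op L nL S \<longleftrightarrow> bounded_op L nL S \<and>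
     (\<forall>f::nat \<Rightarrow> cseq. (\<forall>n. f n \<in> L \<and> nL (f n) \<le> 1) \<longrightarrow>
        (\<exists>(r::nat \<Rightarrow> nat) y. strict_mono r \<and> y \<in> L \<and> (\<lambda>n. nL (\<lambda>i. S (f (r n)) i - y i)) \<longlonglongrightarrow> 0))"

text \<open>Essential spectrum: spectrum of the class of T in the Calkin algebra B(L)/K(L), i.e.
  those lambda for which lambda I - T has no inverse modulo compact operators.\<close>
definition ess_spectrum :: "cseq set \<Rightarrow> (cseq \<Rightarrow> real) \<Rightarrow> (cseq \<Rightarrow> cseq) \<Rightarrow> complex set" where
  "ess_spectrum L nL T = {lam. \<not> (\<exists>S. bounded_op L nL S \<and>
       compact_op L nL (\<lambda>x i. S (\<lambda>n. lam * x n - T x n) i - x i) \<and>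
       compact_op L nL (\<lambda>x i. (lam * S x i - T (S x) i) - x i))}"

text \<open>Essential spectral radius (0 if the Calkin algebra is trivial, i.e. spectrum empty).\<close>
definition ess_rad :: "cseq set \<Rightarrow> (cseq \<Rightarrow> real) \<Rightarrow> (cseq \<Rightarrow> cseq) \<Rightarrow> real" where
  "ess_rad L nL T = Sup (insert 0 (cmod ` ess_spectrum L nL T))"

end

theory Submission
  imports Defs "HOL-Library.Function_Algebras" "HOL-Complex_Analysis.Great_Picard"
begin

text \<open>Write \<open>P\<^sub>n\<close> for the projection onto the coordinates below \<open>n\<close> and \<open>Q\<^sub>n = I - P\<^sub>n\<close>. As the norm of \<open>L\<close>
  is order continuous, \<open>Q\<^sub>n x \<rightarrow> 0\<close> for every \<open>x\<close>; since \<open>P\<^sub>n T\<close> is compact, \<open>\<gamma>(T)\<close> is the infimum of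
  the norms of \<open>Q\<^sub>n T\<close>. Hence \<open>\<gamma>\<close> is a submultiplicative seminorm that vanishes on compact operators and is
  monotone under domination. The entries of a positive matrix are bounded by its norm, so after normalisation
  the weighted AM-GM inequality bounds a Hadamard product with exponents of sum at least 1 by a convex
  combination of its factors; this gives both the Hoelder inequality for matrix products and the
  inequality for \<open>\<gamma>\<close>. The claims on the essential spectral radius follow by applying these to powers, once
  \<open>\<rho>\<^sub>e\<^sub>s\<^sub>s(T) < s\<close> is known to force \<open>\<gamma>(T\<^sup>N) \<le> s\<^sup>N\<close> for some \<open>N \<ge> 1\<close>. For positive \<open>T\<close> this is a Pringsheim argument
  on the positive real axis and needs no vector-valued complex analysis; the converse is a Neumann series
  for \<open>\<lambda>\<^sup>N - Q\<^sub>n T\<^sup>N\<close>.\<close>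

section \<open>Banach sequence spaces with order continuous norm\<close>

text \<open>\<open>ess_rad\<close> is defined through the spectrum, which offers no direct
  comparison when matrix entries grow, whereas \<gamma> of powers does. Each estimate of
  \<open>ess_rad\<close> is therefore turned into an estimate of \<gamma> at one exponent N, with a
  bound s strictly above the radius, and the slack is removed at the end. A bound at one exponent
  passes to its multiples, so finitely many matrices can share an exponent; the Hoelder inequality
  with N equal factors then compares the N-th power of a Hadamard product with the Hadamard product
  of the N-th powers.

  The exponents may add up to more than 1, and AM-GM then needs numbers that are at most 1. This is
  the reason for dividing by norm bounds: unit vectors have norm 1, so no entry exceeds the norm.
  For \<gamma> the division must use bounds on the truncated operators \<open>Q\<^sub>n T\<close>.
  They control only the entries in rows from n on, but those are the only rows that
  \<open>Q\<^sub>n\<close> keeps.\<close>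

definition smul :: "complex \<Rightarrow> cseq \<Rightarrow> cseq" where
  "smul c x = (\<lambda>n. c * x n)"

definition head :: "nat \<Rightarrow> cseq \<Rightarrow> cseq" where
  "head n x = (\<lambda>i. if i < n then x i else 0)"

definition tail :: "nat \<Rightarrow> cseq \<Rightarrow> cseq" where
  "tail n x = (\<lambda>i. if i < n then 0 else x i)"

definition cabs :: "cseq \<Rightarrow> cseq" where
  "cabs x = (\<lambda>i. complex_of_real (cmod (x i)))"

lemma smul_apply [simp]: "smul c x n = c * x n"
  by (simp add: smul_def)

lemma smul_simps [simp]:
  "smul 1 x = x" "smul 0 x = 0" "smul c 0 = 0" "smul c (smul d x) = smul (c * d) x"
  by (simp_all add: smul_def fun_eq_iff)

lemma smul_add: "smul c (x + y) = smul c x + smul c y"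
  and smul_diff: "smul c (x - y) = smul c x - smul c y"
  by (simp_all add: fun_eq_iff algebra_simps)

lemma sum_apply: "(\<Sum>a\<in>A. f a) i = (\<Sum>a\<in>A. f a i :: 'b :: comm_monoid_add)"
  by (induction A rule: infinite_finite_induct) auto

lemma head_add_tail: "head n x + tail n x = x"
  by (simp add: head_def tail_def fun_eq_iff)

lemma cabs_apply [simp]: "cabs x i = complex_of_real (cmod (x i))"
  by (simp add: cabs_def)

lemma seq_pos_cabs [simp]: "seq_pos (cabs x)"
  by (simp add: seq_pos_def)

lemma seq_posD: "seq_pos x \<Longrightarrow> x i = complex_of_real (cmod (x i))"
  unfolding seq_pos_def by (simp add: complex_eq_iff cmod_eq_Re)

lemma cabs_pos: "seq_pos x \<Longrightarrow> cabs x = x"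
  using seq_posD[of x] by (auto simp: fun_eq_iff)

locale seq_space =
  fixes R :: "nat set" and L :: "cseq set" and nL :: "cseq \<Rightarrow> real"
  assumes in_class: "in_class_L R L nL"
    and order_cont: "order_cont_norm L seq_pos nL seq_sub (\<lambda>n. 0)"
begin

lemma banach: "banach_seq_space R L nL"
  using in_class by (simp add: in_class_L_def)

lemma unitvec_L: "n \<in> R \<Longrightarrow> unitvec n \<in> L" "n \<in> R \<Longrightarrow> nL (unitvec n) = 1"
  using in_class by (simp_all add: in_class_L_def)

lemma L_outside: "x \<in> L \<Longrightarrow> n \<notin> R \<Longrightarrow> x n = 0"
  using banach by (simp add: banach_seq_space_def)

lemma L_zero [simp]: "0 \<in> L"
  using banach by (simp add: banach_seq_space_def zero_fun_def)

lemma L_add [simp]: "x \<in> L \<Longrightarrow> y \<in> L \<Longrightarrow> x + y \<in> L"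
  using banach unfolding banach_seq_space_def plus_fun_def by blast

lemma L_smul [simp]: "x \<in> L \<Longrightarrow> smul c x \<in> L"
  using banach unfolding banach_seq_space_def smul_def by blast

lemma diff_smul: "x - y = x + smul (-1) y"
  by (simp add: fun_eq_iff)

lemma L_diff [simp]: "x \<in> L \<Longrightarrow> y \<in> L \<Longrightarrow> x - y \<in> L"
  by (simp add: diff_smul)

lemma L_sum [simp]: "(\<And>a. a \<in> A \<Longrightarrow> f a \<in> L) \<Longrightarrow> sum f A \<in> L"
  by (induction A rule: infinite_finite_induct) auto

lemma norm_eq_0: "x \<in> L \<Longrightarrow> nL x = 0 \<longleftrightarrow> x = 0"
  using banach unfolding banach_seq_space_def zero_fun_def by blast

lemma norm_zero [simp]: "nL 0 = 0"
  by (simp add: norm_eq_0)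

lemma norm_nonneg [simp]: "x \<in> L \<Longrightarrow> 0 \<le> nL x"
  using banach by (simp add: banach_seq_space_def)

lemma norm_smul [simp]: "x \<in> L \<Longrightarrow> nL (smul c x) = cmod c * nL x"
  using banach unfolding banach_seq_space_def smul_def by blast

lemma norm_add: "x \<in> L \<Longrightarrow> y \<in> L \<Longrightarrow> nL (x + y) \<le> nL x + nL y"
  using banach unfolding banach_seq_space_def plus_fun_def by blast

lemma norm_diff: "x \<in> L \<Longrightarrow> y \<in> L \<Longrightarrow> nL (x - y) \<le> nL x + nL y"
  using norm_add[of x "smul (-1) y"] by (simp add: diff_smul)

lemma norm_diff_commute: "x \<in> L \<Longrightarrow> y \<in> L \<Longrightarrow> nL (x - y) = nL (y - x)"
  using norm_smul[of "x - y" "-1"] by (simp add: smul_diff diff_smul add.commute smul_add)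

lemma norm_triangle: "x \<in> L \<Longrightarrow> y \<in> L \<Longrightarrow> z \<in> L \<Longrightarrow> nL (x - z) \<le> nL (x - y) + nL (y - z)"
  using norm_add[of "x - y" "y - z"] by simp

lemma norm_sum: "(\<And>a. a \<in> A \<Longrightarrow> f a \<in> L) \<Longrightarrow> nL (sum f A) \<le> (\<Sum>a\<in>A. nL (f a))"
proof (induction A rule: infinite_finite_induct)
  case (insert a A)
  then have "nL (f a + sum f A) \<le> nL (f a) + nL (sum f A)"
    by (intro norm_add) auto
  with insert show ?case
    by (subst (1 2) sum.insert) (auto intro: order.trans)
qed auto

lemma solid:
  assumes "y \<in> L" "\<And>n. cmod (x n) \<le> cmod (y n)"
  shows "x \<in> L" "nL x \<le> nL y"
  using banach assms unfolding banach_seq_space_def by blast+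

lemma complete:
  assumes "\<And>n. f n \<in> L" "\<And>e. e > 0 \<Longrightarrow> \<exists>N. \<forall>p\<ge>N. \<forall>q\<ge>N. nL (f p - f q) < e"
  obtains y where "y \<in> L" "(\<lambda>n. nL (f n - y)) \<longlonglongrightarrow> 0"
  using banach assms unfolding banach_seq_space_def fun_diff_def by blast

text \<open>Serves twice: for the Neumann series, and for the single vector that exposes an
  unbounded positive matrix.\<close>

lemma series_complete:
  assumes y: "\<And>n. y n \<in> L" and sum: "summable (\<lambda>n. nL (y n))"
  obtains z where "z \<in> L" "(\<lambda>M. nL ((\<Sum>n<M. y n) - z)) \<longlonglongrightarrow> 0"
proof (rule complete[of "\<lambda>M. \<Sum>n<M. y n"])
  have fL: "(\<Sum>n<M. y n) \<in> L" for M
    by (rule L_sum) (rule y)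
  show "(\<Sum>n<M. y n) \<in> L" for M
    by (rule fL)
  fix e :: real assume "e > 0"
  then obtain N where N: "\<And>m n. m \<ge> N \<Longrightarrow> norm (\<Sum>i\<in>{m..<n}. nL (y i)) < e"
    using sum unfolding summable_Cauchy by meson
  have small: "nL ((\<Sum>n<p. y n) - (\<Sum>n<q. y n)) < e" if "q \<ge> N" "p \<ge> q" for p q
  proof -
    have "(\<Sum>n<p. y n) - (\<Sum>n<q. y n) = (\<Sum>i\<in>{q..<p}. y i)"
      using sum_diff_nat_ivl[of 0 q p y] that(2) by (simp add: atLeast0LessThan)
    then have "nL ((\<Sum>n<p. y n) - (\<Sum>n<q. y n)) \<le> (\<Sum>i\<in>{q..<p}. nL (y i))"
      using norm_sum[of "{q..<p}" y] y by simp
    with N[OF that(1), of p] show ?thesis by simp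
  qed
  show "\<exists>N. \<forall>p\<ge>N. \<forall>q\<ge>N. nL ((\<Sum>n<p. y n) - (\<Sum>n<q. y n)) < e"
  proof (intro exI[of _ N] allI impI)
    fix p q assume "p \<ge> N" "q \<ge> N"
    then show "nL ((\<Sum>n<p. y n) - (\<Sum>n<q. y n)) < e"
      using small[of q p] small[of p q] norm_diff_commute[OF fL fL, of p q]
      by (cases "p \<le> q") auto
  qed
qed (rule that)

lemma cabs_L [simp]: "x \<in> L \<Longrightarrow> cabs x \<in> L" "x \<in> L \<Longrightarrow> nL (cabs x) = nL x"
proof -
  show *: "cabs x \<in> L" if "x \<in> L"
    by (rule solid[of x]) (simp_all add: that)
  show "nL (cabs x) = nL x" if "x \<in> L"
    using solid(2)[of x "cabs x"] solid(2)[of "cabs x" x] * that by force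
qed

text \<open>The multiple \<open>smul (x i) (unitvec i)\<close> lies below \<open>x\<close> in
  modulus, and unit vectors have norm 1. Through this bound norm convergence controls coordinates,
  and operator norms control matrix entries.\<close>

lemma coord_le: assumes "x \<in> L" shows "cmod (x i) \<le> nL x"
proof (cases "i \<in> R")
  case True
  have "nL (smul (x i) (unitvec i)) \<le> nL x"
    by (rule solid(2)[OF assms]) (simp add: unitvec_def)
  then show ?thesis
    using unitvec_L[OF True] by simp
qed (use assms L_outside[of x i] in simp)

lemma norm_lim_coord:
  assumes "\<And>n. f n \<in> L" "y \<in> L" "(\<lambda>n. nL (f n - y)) \<longlonglongrightarrow> 0"
  shows "(\<lambda>n. f n i) \<longlonglongrightarrow> y i"
proof -
  have "(\<lambda>n. f n i - y i) \<longlonglongrightarrow> 0"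
    using assms(3) by (rule Lim_null_comparison[rotated])
      (use coord_le[of "f _ - y" i] assms(1,2) in \<open>simp add: eventually_sequentially\<close>)
  then show ?thesis
    by (simp add: LIM_zero_iff)
qed

lemma head_L [simp]: "x \<in> L \<Longrightarrow> head n x \<in> L" and head_le: "x \<in> L \<Longrightarrow> nL (head n x) \<le> nL x"
  using solid[of x "head n x"] by (simp_all add: head_def)

lemma tail_L [simp]: "x \<in> L \<Longrightarrow> tail n x \<in> L" and tail_le: "x \<in> L \<Longrightarrow> nL (tail n x) \<le> nL x"
  using solid[of x "tail n x"] by (simp_all add: tail_def)

lemma tail_mono: "x \<in> L \<Longrightarrow> m \<le> n \<Longrightarrow> nL (tail n x) \<le> nL (tail m x)"
  by (rule solid(2)[OF tail_L]) (auto simp: tail_def)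

lemma head_eq_sum:
  assumes "x \<in> L"
  shows "head n x = (\<Sum>i\<in>{..<n} \<inter> R. smul (x i) (unitvec i))"
proof
  fix j
  have "(\<Sum>i\<in>{..<n} \<inter> R. x i * unitvec i j) = (\<Sum>i\<in>{..<n} \<inter> R. if i = j then x i else 0)"
    by (rule sum.cong) (auto simp: unitvec_def)
  then show "head n x j = (\<Sum>i\<in>{..<n} \<inter> R. smul (x i) (unitvec i)) j"
    using assms L_outside[of x j] by (simp add: sum_apply head_def)
qed

lemma norm_head_le: assumes "x \<in> L" shows "nL (head n x) \<le> (\<Sum>i<n. cmod (x i))"
proof -
  have "nL (head n x) \<le> (\<Sum>i\<in>{..<n} \<inter> R. nL (smul (x i) (unitvec i)))"
    unfolding head_eq_sum[OF assms] by (rule norm_sum) (use unitvec_L in auto)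
  also have "\<dots> = (\<Sum>i\<in>{..<n} \<inter> R. cmod (x i))"
    by (rule sum.cong) (auto simp: unitvec_L)
  also have "\<dots> \<le> (\<Sum>i<n. cmod (x i))"
    by (rule sum_mono2) auto
  finally show ?thesis .
qed

lemma tail_small:
  assumes "x \<in> L" "e > 0"
  obtains n where "\<And>m. m \<ge> n \<Longrightarrow> nL (tail m x) < e"
proof -
  \<comment> \<open>The tails of |x| are the decreasing family to which order continuity is
    applied.\<close>
  let ?D = "range (\<lambda>n. tail n (cabs x))"
  have "\<exists>f\<in>?D. nL f < e"
  proof (rule order_cont[unfolded order_cont_norm_def, rule_format, of ?D])
    show "?D \<subseteq> L \<and> ?D \<noteq> {} \<and> (\<forall>f\<in>?D. seq_pos f) \<and>
      (\<forall>f\<in>?D. \<forall>g\<in>?D. \<exists>h\<in>?D. seq_pos (seq_sub f h) \<and> seq_pos (seq_sub g h)) \<and>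
      (\<forall>h\<in>L. seq_pos h \<and> (\<forall>f\<in>?D. seq_pos (seq_sub f h)) \<longrightarrow> h = (\<lambda>n. 0))"
    proof (intro conjI ballI impI)
      show "\<exists>h\<in>?D. seq_pos (seq_sub f h) \<and> seq_pos (seq_sub g h)" if fg: "f \<in> ?D" "g \<in> ?D" for f g
      proof -
        obtain p q where "f = tail p (cabs x)" "g = tail q (cabs x)"
          using fg by blast
        then show ?thesis
          by (intro bexI[of _ "tail (max p q) (cabs x)"]) (auto simp: seq_pos_def seq_sub_def tail_def)
      qed
      show "h = (\<lambda>n. 0)" if h: "seq_pos h \<and> (\<forall>f\<in>?D. seq_pos (seq_sub f h))" for h
      proof
        fix i
        \<comment> \<open>The tail starting at \<open>Suc i\<close> is 0 at coordinate
          \<open>i\<close>, so a positive lower bound vanishes there.\<close>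
        have "seq_pos (seq_sub (tail (Suc i) (cabs x)) h)" "seq_pos h"
          using h by blast+
        then have "0 \<le> Re (h i)" "0 \<le> - Re (h i)" "Im (h i) = 0"
          unfolding seq_pos_def seq_sub_def tail_def by (force dest: spec[of _ i])+
        then show "h i = 0"
          by (simp add: complex_eq_iff)
      qed
    qed (use assms in \<open>auto simp: seq_pos_def tail_def intro!: tail_L[unfolded tail_def] cabs_L(1)[unfolded cabs_def]\<close>)
    show "e > 0" by fact
  qed
  then obtain n where n: "nL (tail n (cabs x)) < e"
    by blast
  show thesis
  proof
    fix m assume "m \<ge> n"
    have "nL (tail m x) \<le> nL (tail n (cabs x))"
      by (rule solid(2)[OF tail_L[OF cabs_L(1)[OF assms(1)]]]) (use \<open>m \<ge> n\<close> in \<open>auto simp: tail_def\<close>)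
    with n show "nL (tail m x) < e" by simp
  qed
qed

lemma head_lim: assumes "x \<in> L" shows "(\<lambda>n. nL (head n x - x)) \<longlonglongrightarrow> 0"
proof (rule LIMSEQ_I)
  fix e :: real assume "e > 0"
  with assms obtain n where n: "\<And>m. m \<ge> n \<Longrightarrow> nL (tail m x) < e"
    by (rule tail_small) blast
  have *: "nL (head m x - x) = nL (tail m x)" for m
    using norm_diff_commute[of "head m x" x] assms head_add_tail[of m x]
    by (metis add_diff_cancel_left' head_L)
  show "\<exists>no. \<forall>m\<ge>no. norm (nL (head m x - x) - 0) < e"
    unfolding * using n assms by (intro exI[of _ n]) simp
qed

end

section \<open>Bounded and compact operators\<close>

context seq_space
begin

lemma bounded_opI:
  assumes "\<And>x. x \<in> L \<Longrightarrow> S x \<in> L"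
    and "\<And>x y. x \<in> L \<Longrightarrow> y \<in> L \<Longrightarrow> S (x + y) = S x + S y"
    and "\<And>x c. x \<in> L \<Longrightarrow> S (smul c x) = smul c (S x)"
    and "\<And>x. x \<in> L \<Longrightarrow> nL (S x) \<le> K * nL x"
  shows "bounded_op L nL S"
  using assms unfolding bounded_op_def plus_fun_def smul_def by blast

lemma
  assumes "bounded_op L nL S"
  shows op_L: "x \<in> L \<Longrightarrow> S x \<in> L"
    and op_add: "x \<in> L \<Longrightarrow> y \<in> L \<Longrightarrow> S (x + y) = S x + S y"
    and op_smul: "x \<in> L \<Longrightarrow> S (smul c x) = smul c (S x)"
  using assms unfolding bounded_op_def plus_fun_def smul_def by blast+

lemma
  assumes S: "bounded_op L nL S"
  shows op_diff: "x \<in> L \<Longrightarrow> y \<in> L \<Longrightarrow> S (x - y) = S x - S y"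
    and op_zero: "S 0 = 0"
    and op_sum: "(\<And>a. a \<in> A \<Longrightarrow> f a \<in> L) \<Longrightarrow> S (sum f A) = (\<Sum>a\<in>A. S (f a))"
proof -
  show "x \<in> L \<Longrightarrow> y \<in> L \<Longrightarrow> S (x - y) = S x - S y"
    by (simp add: diff_smul op_add[OF S] op_smul[OF S])
  show 0: "S 0 = 0"
    using op_smul[OF S, of 0 0] by simp
  show "S (sum f A) = (\<Sum>a\<in>A. S (f a))" if "\<And>a. a \<in> A \<Longrightarrow> f a \<in> L"
    using that by (induction A rule: infinite_finite_induct) (simp_all add: op_add[OF S] 0)
qed

lemma op_bound:
  assumes "bounded_op L nL S"
  obtains K where "K > 0" "\<And>x. x \<in> L \<Longrightarrow> nL (S x) \<le> K * nL x"
proof -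
  obtain K where K: "\<And>x. x \<in> L \<Longrightarrow> nL (S x) \<le> K * nL x"
    using assms unfolding bounded_op_def by blast
  show thesis
  proof
    fix x assume "x \<in> L"
    then have "K * nL x \<le> (\<bar>K\<bar> + 1) * nL x"
      by (intro mult_right_mono) auto
    with K[OF \<open>x \<in> L\<close>] show "nL (S x) \<le> (\<bar>K\<bar> + 1) * nL x" by simp
  qed simp
qed

lemma op_cong:
  assumes S: "bounded_op L nL S" and eq: "\<And>x. x \<in> L \<Longrightarrow> T x = S x"
  shows "bounded_op L nL T"
proof -
  obtain K where "\<And>x. x \<in> L \<Longrightarrow> nL (S x) \<le> K * nL x"
    using op_bound[OF S] by blast
  then show ?thesis
    by (intro bounded_opI[where K = K]) (simp_all add: eq op_L[OF S] op_add[OF S] op_smul[OF S])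
qed

lemma bounded_id [simp]: "bounded_op L nL id"
  by (rule bounded_opI[where K = 1]) auto

lemma bounded_comp [simp]:
  assumes "bounded_op L nL S" "bounded_op L nL T"
  shows "bounded_op L nL (S \<circ> T)"
proof -
  obtain K K' where K: "K > 0" "\<And>x. x \<in> L \<Longrightarrow> nL (S x) \<le> K * nL x"
    and K': "K' > 0" "\<And>x. x \<in> L \<Longrightarrow> nL (T x) \<le> K' * nL x"
    using assms op_bound by metis
  have "nL (S (T x)) \<le> (K * K') * nL x" if "x \<in> L" for x
    using order.trans[OF K(2)[OF op_L[OF assms(2) that]] mult_left_mono[OF K'(2)[OF that]]] K(1)
    by (simp add: mult.assoc)
  then show ?thesis
    by (intro bounded_opI[where K = "K * K'"])
      (simp_all add: op_L[OF assms(1)] op_L[OF assms(2)] op_add[OF assms(1)] op_add[OF assms(2)]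
        op_smul[OF assms(1)] op_smul[OF assms(2)])
qed

lemma bounded_add [simp]:
  assumes "bounded_op L nL S" "bounded_op L nL T"
  shows "bounded_op L nL (S + T)"
proof -
  obtain K K' where K: "K > 0" "\<And>x. x \<in> L \<Longrightarrow> nL (S x) \<le> K * nL x"
    and K': "K' > 0" "\<And>x. x \<in> L \<Longrightarrow> nL (T x) \<le> K' * nL x"
    using assms op_bound by metis
  have "nL (S x + T x) \<le> (K + K') * nL x" if "x \<in> L" for x
    using norm_add[OF op_L[OF assms(1) that] op_L[OF assms(2) that]] K(2)[OF that] K'(2)[OF that]
    by (simp add: distrib_right)
  then show ?thesis
    by (intro bounded_opI[where K = "K + K'"])
      (simp_all add: op_L[OF assms(1)] op_L[OF assms(2)] op_add[OF assms(1)] op_add[OF assms(2)]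
        op_smul[OF assms(1)] op_smul[OF assms(2)] smul_add)
qed

lemma bounded_smul [simp]: "bounded_op L nL (smul c)"
  by (rule bounded_opI[where K = "cmod c"]) (auto simp: smul_add mult.commute)

lemma bounded_diff [simp]:
  assumes "bounded_op L nL S" "bounded_op L nL T"
  shows "bounded_op L nL (S - T)"
  by (rule op_cong[of "S + (smul (-1) \<circ> T)"]) (simp_all add: assms diff_smul)

lemma bounded_zero [simp]: "bounded_op L nL 0"
  by (rule bounded_opI[where K = 0]) auto

lemma bounded_sum [simp]:
  "(\<And>a. a \<in> A \<Longrightarrow> bounded_op L nL (f a)) \<Longrightarrow> bounded_op L nL (sum f A)"
  by (induction A rule: infinite_finite_induct) auto

lemma bounded_funpow [simp]: "bounded_op L nL T \<Longrightarrow> bounded_op L nL (T ^^ n)"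
  by (induction n) auto

lemma bounded_head [simp]: "bounded_op L nL (head n)"
  by (rule bounded_opI[where K = 1]) (auto simp: head_le, auto simp: head_def fun_eq_iff)

lemma bounded_tail [simp]: "bounded_op L nL (tail n)"
  by (rule bounded_opI[where K = 1]) (auto simp: tail_le, auto simp: tail_def fun_eq_iff)

section \<open>Compact operators: an ideal that contains the projections to finitely many
  coordinates\<close>

lemma compact_bounded: "compact_op L nL S \<Longrightarrow> bounded_op L nL S"
  by (simp add: compact_op_def)

lemma compact_opI:
  assumes "bounded_op L nL S"
    and "\<And>f. (\<And>n. f n \<in> L) \<Longrightarrow> (\<And>n. nL (f n) \<le> 1) \<Longrightarrow>
      \<exists>(r :: nat \<Rightarrow> nat) y. strict_mono r \<and> y \<in> L \<and> (\<lambda>n. nL (S (f (r n)) - y)) \<longlonglongrightarrow> 0"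
  shows "compact_op L nL S"
  using assms unfolding compact_op_def fun_diff_def by blast

lemma compact_opE:
  assumes "compact_op L nL S" "\<And>n. f n \<in> L" "\<And>n. nL (f n) \<le> 1"
  obtains r :: "nat \<Rightarrow> nat" and y
    where "strict_mono r" "y \<in> L" "(\<lambda>n. nL (S (f (r n)) - y)) \<longlonglongrightarrow> 0"
  using assms unfolding compact_op_def fun_diff_def by blast

lemma compact_cong:
  assumes "compact_op L nL S" "\<And>x. x \<in> L \<Longrightarrow> T x = S x"
  shows "compact_op L nL T"
proof (rule compact_opI)
  show "bounded_op L nL T"
    using assms compact_bounded op_cong by blast
  fix f :: "nat \<Rightarrow> cseq" assume f: "\<And>n. f n \<in> L" "\<And>n. nL (f n) \<le> 1"
  obtain r :: "nat \<Rightarrow> nat" and y where "strict_mono r" "y \<in> L" "(\<lambda>n. nL (S (f (r n)) - y)) \<longlonglongrightarrow> 0"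
    by (rule compact_opE[OF assms(1) f])
  then show "\<exists>(r :: nat \<Rightarrow> nat) y. strict_mono r \<and> y \<in> L \<and> (\<lambda>n. nL (T (f (r n)) - y)) \<longlonglongrightarrow> 0"
    using assms(2)[OF f(1)] by auto
qed

lemma compact_comp_left:
  assumes "bounded_op L nL S" "compact_op L nL T"
  shows "compact_op L nL (S \<circ> T)"
proof (rule compact_opI)
  show "bounded_op L nL (S \<circ> T)"
    using assms by (simp add: compact_bounded)
  fix f :: "nat \<Rightarrow> cseq" assume f: "\<And>n. f n \<in> L" "\<And>n. nL (f n) \<le> 1"
  obtain r :: "nat \<Rightarrow> nat" and y where r: "strict_mono r" "y \<in> L" "(\<lambda>n. nL (T (f (r n)) - y)) \<longlonglongrightarrow> 0"
    by (rule compact_opE[OF assms(2) f])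
  obtain K where K: "K > 0" "\<And>x. x \<in> L \<Longrightarrow> nL (S x) \<le> K * nL x"
    using op_bound[OF assms(1)] by blast
  have TL: "T (f n) \<in> L" for n
    by (rule op_L[OF compact_bounded[OF assms(2)] f(1)])
  have lim: "(\<lambda>n. nL (S (T (f (r n))) - S y)) \<longlonglongrightarrow> 0"
  proof (rule Lim_null_comparison)
    have "norm (nL (S z - S y)) \<le> K * nL (z - y)" if "z \<in> L" for z
      using K(2)[of "z - y"] that r(2) by (simp add: op_diff[OF assms(1)] op_L[OF assms(1)])
    then show "\<forall>\<^sub>F n in sequentially. norm (nL (S (T (f (r n))) - S y)) \<le> K * nL (T (f (r n)) - y)"
      using TL by (intro always_eventually allI) blast
    show "(\<lambda>n. K * nL (T (f (r n)) - y)) \<longlonglongrightarrow> 0"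
      using tendsto_mult_left[OF r(3), of K] by simp
  qed
  then show "\<exists>(r :: nat \<Rightarrow> nat) y. strict_mono r \<and> y \<in> L \<and> (\<lambda>n. nL ((S \<circ> T) (f (r n)) - y)) \<longlonglongrightarrow> 0"
    using \<open>strict_mono r\<close> lim op_L[OF assms(1) \<open>y \<in> L\<close>] by (intro exI[of _ r] exI[of _ "S y"]) simp
qed

lemma compact_comp_right:
  assumes "compact_op L nL S" "bounded_op L nL T"
  shows "compact_op L nL (S \<circ> T)"
proof (rule compact_opI)
  have S: "bounded_op L nL S"
    using assms(1) by (rule compact_bounded)
  show "bounded_op L nL (S \<circ> T)"
    using assms S by simp
  fix f :: "nat \<Rightarrow> cseq" assume f: "\<And>n. f n \<in> L" "\<And>n. nL (f n) \<le> 1"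
  obtain K where K: "K > 0" "\<And>x. x \<in> L \<Longrightarrow> nL (T x) \<le> K * nL x"
    using op_bound[OF assms(2)] by blast
  \<comment> \<open>Compactness is tested on the unit ball only, so the images under
    \<open>T\<close> are scaled back into it.\<close>
  let ?g = "\<lambda>n. smul (of_real (1 / K)) (T (f n))"
  have TL: "T (f n) \<in> L" for n
    by (rule op_L[OF assms(2) f(1)])
  have "nL (?g n) \<le> 1" for n
    using order.trans[OF K(2)[OF f(1)[of n]] mult_left_mono[OF f(2)[of n], of K]] K(1)
    by (simp add: norm_smul[OF TL] norm_divide divide_simps)
  then obtain r :: "nat \<Rightarrow> nat" and y where r: "strict_mono r" "y \<in> L" "(\<lambda>n. nL (S (?g (r n)) - y)) \<longlonglongrightarrow> 0"
    by (rule compact_opE[OF assms(1), of ?g, OF L_smul[OF TL]]) simp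
  have eq: "S (T (f n)) - smul (of_real K) y = smul (of_real K) (S (?g n) - y)" for n
    using K(1) TL by (simp add: op_smul[OF S] smul_diff)
  have "nL (S (T (f n)) - smul (of_real K) y) = K * nL (S (?g n) - y)" for n
    unfolding eq using K(1) TL r(2) by (simp add: op_L[OF S] del: smul_simps(4))
  with tendsto_mult_left[OF r(3), of K]
  have lim: "(\<lambda>n. nL (S (T (f (r n))) - smul (of_real K) y)) \<longlonglongrightarrow> 0"
    by simp
  then show "\<exists>(r :: nat \<Rightarrow> nat) y. strict_mono r \<and> y \<in> L \<and> (\<lambda>n. nL ((S \<circ> T) (f (r n)) - y)) \<longlonglongrightarrow> 0"
    using r(1,2) lim by (intro exI[of _ r] exI[of _ "smul (of_real K) y"]) simp
qed

lemma compact_add: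
  assumes "compact_op L nL S" "compact_op L nL T"
  shows "compact_op L nL (S + T)"
proof (rule compact_opI)
  have ST: "bounded_op L nL S" "bounded_op L nL T"
    using assms by (simp_all add: compact_bounded)
  then show "bounded_op L nL (S + T)" by simp
  fix f :: "nat \<Rightarrow> cseq" assume f: "\<And>n. f n \<in> L" "\<And>n. nL (f n) \<le> 1"
  obtain r :: "nat \<Rightarrow> nat" and y where r: "strict_mono r" "y \<in> L" "(\<lambda>n. nL (S (f (r n)) - y)) \<longlonglongrightarrow> 0"
    by (rule compact_opE[OF assms(1) f])
  obtain q :: "nat \<Rightarrow> nat" and z where q: "strict_mono q" "z \<in> L" "(\<lambda>n. nL (T (f (r (q n))) - z)) \<longlonglongrightarrow> 0"
    by (rule compact_opE[OF assms(2), of "\<lambda>n. f (r n)"]) (simp_all add: f)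
  have lim: "(\<lambda>n. nL ((S + T) (f (r (q n))) - (y + z))) \<longlonglongrightarrow> 0"
  proof (rule Lim_null_comparison)
    have eq: "(S + T) x - (y + z) = (S x - y) + (T x - z)" for x
      by (simp add: fun_eq_iff)
    have "nL ((S + T) x - (y + z)) \<le> nL (S x - y) + nL (T x - z)" if "x \<in> L" for x
      unfolding eq using norm_add[of "S x - y" "T x - z"] op_L[OF ST(1)] op_L[OF ST(2)] r(2) q(2) that by simp
    moreover have "0 \<le> nL ((S + T) x - (y + z))" if "x \<in> L" for x
      using op_L[OF ST(1)] op_L[OF ST(2)] r(2) q(2) that by (intro norm_nonneg L_diff L_add) auto
    ultimately show "\<forall>\<^sub>F n in sequentially. norm (nL ((S + T) (f (r (q n))) - (y + z)))
        \<le> nL (S (f (r (q n))) - y) + nL (T (f (r (q n))) - z)"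
      using f(1) by (intro always_eventually) simp
    show "(\<lambda>n. nL (S (f (r (q n))) - y) + nL (T (f (r (q n))) - z)) \<longlonglongrightarrow> 0"
      using tendsto_add[OF LIMSEQ_subseq_LIMSEQ[OF r(3) q(1)] q(3)] by (simp add: comp_def)
  qed
  then show "\<exists>(r :: nat \<Rightarrow> nat) y. strict_mono r \<and> y \<in> L \<and> (\<lambda>n. nL ((S + T) (f (r n)) - y)) \<longlonglongrightarrow> 0"
    using lim r(2) q(2) strict_mono_o[OF r(1) q(1)] by (intro exI[of _ "r \<circ> q"] exI[of _ "y + z"]) simp
qed

text \<open>Coordinates in the unit ball are bounded by 1, so a diagonal subsequence converges at
  every index; on the finitely many indices below \<open>n\<close> the norm is at most the sum of
  the moduli.\<close>

lemma compact_head: "compact_op L nL (head n)"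
proof (rule compact_opI)
  fix f :: "nat \<Rightarrow> cseq" assume f: "\<And>n. f n \<in> L" "\<And>n. nL (f n) \<le> 1"
  have "cmod (f k i) \<le> 1" for k i
    using coord_le[OF f(1)[of k], of i] f(2)[of k] by simp
  then obtain r :: "nat \<Rightarrow> nat" where r: "strict_mono r" "\<And>i. i \<in> UNIV \<Longrightarrow> \<exists>l. (\<lambda>k. f (r k) i) \<longlonglongrightarrow> l"
    using function_convergent_subsequence[of UNIV f 1] by blast
  then obtain y where y: "\<And>i. (\<lambda>k. f (r k) i) \<longlonglongrightarrow> y i"
    by (metis UNIV_I)
  \<comment> \<open>The coordinatewise limit \<open>y\<close> need not lie in \<open>L\<close>. Only
    its head has to, and for this \<open>y\<close> must vanish off \<open>R\<close>.\<close>
  have "y i = 0" if "i \<notin> R" for i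
    using y[of i] L_outside[OF f(1) that] by (simp add: LIMSEQ_const_iff)
  then have "head n y = (\<Sum>i\<in>{..<n} \<inter> R. smul (y i) (unitvec i))"
    by (fastforce simp: sum_apply head_def unitvec_def fun_eq_iff if_distrib cong: if_cong)
  then have yL: "head n y \<in> L"
    using unitvec_L(1) by (auto intro!: L_sum)
  have "(\<lambda>k. nL (head n (f (r k)) - head n y)) \<longlonglongrightarrow> 0"
  proof (rule Lim_null_comparison)
    have "norm (nL (head n (f (r k)) - head n y)) \<le> (\<Sum>i<n. cmod (f (r k) i - y i))" for k
    proof -
      let ?z = "head n (f (r k)) - head n y"
      have zL: "?z \<in> L" using f yL by simp
      have "head n ?z = ?z" by (simp add: head_def fun_eq_iff)
      with norm_head_le[OF zL, of n] have "nL ?z \<le> (\<Sum>i<n. cmod (?z i))" by simp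
      also have "\<dots> = (\<Sum>i<n. cmod (f (r k) i - y i))"
        by (simp add: head_def)
      finally show ?thesis using zL by simp
    qed
    then show "\<forall>\<^sub>F k in sequentially. norm (nL (head n (f (r k)) - head n y)) \<le> (\<Sum>i<n. cmod (f (r k) i - y i))"
      by simp
    have "(\<lambda>k. \<Sum>i<n. cmod (f (r k) i - y i)) \<longlonglongrightarrow> (\<Sum>i<n. cmod (y i - y i))"
      by (intro tendsto_intros y)
    then show "(\<lambda>k. \<Sum>i<n. cmod (f (r k) i - y i)) \<longlonglongrightarrow> 0" by simp
  qed
  with r(1) yL show "\<exists>(r :: nat \<Rightarrow> nat) y. strict_mono r \<and> y \<in> L \<and> (\<lambda>k. nL (head n (f (r k)) - y)) \<longlonglongrightarrow> 0"
    by blast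
qed simp

section \<open>Equality in the Calkin algebra\<close>

definition calkin_eq :: "(cseq \<Rightarrow> cseq) \<Rightarrow> (cseq \<Rightarrow> cseq) \<Rightarrow> bool" (infix "\<sim>" 50) where
  "S \<sim> T \<longleftrightarrow> bounded_op L nL S \<and> bounded_op L nL T \<and> compact_op L nL (S - T)"

lemma compact_zero: "compact_op L nL 0"
  by (rule compact_cong[OF compact_head[of 0]]) (simp add: head_def fun_eq_iff)

lemma compact_smul: "compact_op L nL S \<Longrightarrow> compact_op L nL (smul c \<circ> S)"
  by (rule compact_comp_left) simp_all

lemma calkin_eqI:
  assumes "bounded_op L nL S" "bounded_op L nL T" "compact_op L nL K" "\<And>x. x \<in> L \<Longrightarrow> S x = T x + K x"
  shows "S \<sim> T"
  unfolding calkin_eq_def using assms by (auto intro: compact_cong[of K])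

text \<open>Operators are total functions on sequences, but only their values on \<open>L\<close>
  count. Identities that hold on \<open>L\<close> enter a chain of \<sim> steps through this
  lemma.\<close>

lemma calkin_eq_on: "bounded_op L nL T \<Longrightarrow> (\<And>x. x \<in> L \<Longrightarrow> S x = T x) \<Longrightarrow> S \<sim> T"
  by (rule calkin_eqI[of _ _ 0]) (auto intro: compact_zero op_cong)

lemma calkin_sym: "S \<sim> T \<Longrightarrow> T \<sim> S"
  by (rule calkin_eqI[of _ _ "smul (-1) \<circ> (S - T)"])
    (auto simp: calkin_eq_def fun_eq_iff intro: compact_smul)

lemma calkin_trans [trans]: "S \<sim> T \<Longrightarrow> T \<sim> U \<Longrightarrow> S \<sim> U"
  using compact_add[of "S - T" "T - U"] by (simp add: calkin_eq_def)

lemma calkin_comp_left: "bounded_op L nL U \<Longrightarrow> S \<sim> T \<Longrightarrow> U \<circ> S \<sim> U \<circ> T"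
  unfolding calkin_eq_def
  by (elim conjE, intro calkin_eqI[of _ _ "U \<circ> (S - T)", unfolded calkin_eq_def])
    (simp_all add: compact_comp_left op_diff[of U] op_L[of S] op_L[of T])

lemma calkin_comp_right: "bounded_op L nL U \<Longrightarrow> S \<sim> T \<Longrightarrow> S \<circ> U \<sim> T \<circ> U"
  by (rule calkin_eqI[of _ _ "(S - T) \<circ> U"])
    (auto simp: calkin_eq_def intro: compact_comp_right)

lemma ess_spectrum_iff:
  "lam \<in> ess_spectrum L nL T \<longleftrightarrow>
    \<not> (\<exists>S. bounded_op L nL S \<and> compact_op L nL ((S \<circ> (smul lam - T)) - id)
      \<and> compact_op L nL (((smul lam - T) \<circ> S) - id))"
  unfolding ess_spectrum_def by (simp add: smul_def fun_diff_def comp_def)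

lemma ess_spectrum_calkin:
  assumes "bounded_op L nL T"
  shows "lam \<in> ess_spectrum L nL T \<longleftrightarrow>
    \<not> (\<exists>S. S \<circ> (smul lam - T) \<sim> id \<and> (smul lam - T) \<circ> S \<sim> id \<and> bounded_op L nL S)"
  unfolding ess_spectrum_iff calkin_eq_def using assms by (auto simp del: id_comp comp_id)

end

section \<open>The Hausdorff measure of noncompactness\<close>

context seq_space
begin

text \<open>The finite nets without the infimum: \<gamma> need not be attained, so proofs work with
  nets of slightly larger radius.\<close>

definition covered :: "(cseq \<Rightarrow> cseq) \<Rightarrow> real \<Rightarrow> bool" where
  "covered T d \<longleftrightarrow> (\<exists>M. finite M \<and> M \<subseteq> L \<and> (\<forall>x\<in>L. nL x \<le> 1 \<longrightarrow> (\<exists>y\<in>M. nL (T x - y) \<le> d)))"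

abbreviation mnc :: "(cseq \<Rightarrow> cseq) \<Rightarrow> real" where
  "mnc \<equiv> hmnc L nL"

lemma mnc_Inf: "mnc T = Inf {d. d > 0 \<and> covered T d}"
  by (simp add: hmnc_def covered_def fun_diff_def)

lemma coveredI:
  assumes "finite M" "M \<subseteq> L" "\<And>x. x \<in> L \<Longrightarrow> nL x \<le> 1 \<Longrightarrow> \<exists>y\<in>M. nL (T x - y) \<le> d"
  shows "covered T d"
  using assms unfolding covered_def by blast

lemma coveredE:
  assumes "covered T d"
  obtains M where "finite M" "M \<subseteq> L" "\<And>x. x \<in> L \<Longrightarrow> nL x \<le> 1 \<Longrightarrow> \<exists>y\<in>M. nL (T x - y) \<le> d"
  using assms unfolding covered_def by blast

lemma covered_mono: "covered T c \<Longrightarrow> c \<le> d \<Longrightarrow> covered T d"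
  by (erule coveredE, rule coveredI, assumption+) (blast intro: order.trans)

lemma covered_bound:
  assumes "\<And>x. x \<in> L \<Longrightarrow> nL (T x) \<le> K * nL x" "K \<ge> 0"
  shows "covered T K"
proof (rule coveredI[of "{0}"])
  fix x assume "x \<in> L" "nL x \<le> 1"
  then show "\<exists>y\<in>{0}. nL (T x - y) \<le> K"
    using assms(1)[of x] mult_left_le[of "nL x" K] assms(2) by simp
qed auto

lemma mnc_le: "covered T d \<Longrightarrow> d > 0 \<Longrightarrow> mnc T \<le> d"
  unfolding mnc_Inf by (rule cInf_lower) (auto intro: bdd_belowI[of _ 0])

lemma mnc_le_eps:
  assumes "\<And>e. e > 0 \<Longrightarrow> covered T (d + e)" "d \<ge> 0"
  shows "mnc T \<le> d"
  by (rule field_le_epsilon) (use assms in \<open>auto intro: mnc_le\<close>)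

lemma ex_covered:
  assumes "bounded_op L nL T"
  shows "\<exists>d. d > 0 \<and> covered T d"
proof -
  obtain K where "K > 0" "\<And>x. x \<in> L \<Longrightarrow> nL (T x) \<le> K * nL x"
    using op_bound[OF assms] by blast
  then show ?thesis
    using covered_bound[of T K] by auto
qed

lemma mnc_nonneg: "bounded_op L nL T \<Longrightarrow> 0 \<le> mnc T"
  unfolding mnc_Inf by (rule cInf_greatest) (use ex_covered in auto)

lemma mnc_less:
  assumes "bounded_op L nL T" "mnc T < d"
  shows "covered T d"
proof -
  have "{d. d > 0 \<and> covered T d} \<noteq> {}"
    using ex_covered[OF assms(1)] by blast
  then obtain c where c: "covered T c" "c < d"
    using cInf_lessD[OF _ assms(2)[unfolded mnc_Inf]] by blast
  then show ?thesis
    using covered_mono[OF c(1), of d] by simp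
qed

lemma mnc_bound:
  "(\<And>x. x \<in> L \<Longrightarrow> nL (T x) \<le> K * nL x) \<Longrightarrow> K \<ge> 0 \<Longrightarrow> mnc T \<le> K"
  using covered_mono[OF covered_bound[of T K]] by (intro mnc_le_eps) auto

lemma covered_add:
  assumes "covered S c" "covered T d" and ST: "bounded_op L nL S" "bounded_op L nL T"
  shows "covered (S + T) (c + d)"
proof -
  obtain M where M: "finite M" "M \<subseteq> L" "\<And>x. x \<in> L \<Longrightarrow> nL x \<le> 1 \<Longrightarrow> \<exists>y\<in>M. nL (S x - y) \<le> c"
    using coveredE[OF assms(1)] by metis
  obtain N where N: "finite N" "N \<subseteq> L" "\<And>x. x \<in> L \<Longrightarrow> nL x \<le> 1 \<Longrightarrow> \<exists>y\<in>N. nL (T x - y) \<le> d"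
    using coveredE[OF assms(2)] by metis
  show ?thesis
  proof (rule coveredI[of "(\<lambda>(y, z). y + z) ` (M \<times> N)"])
    show "(\<lambda>(y, z). y + z) ` (M \<times> N) \<subseteq> L"
      using M(2) N(2) by (auto intro!: L_add)
    fix x assume x: "x \<in> L" "nL x \<le> 1"
    obtain y z where y: "y \<in> M" "nL (S x - y) \<le> c" and z: "z \<in> N" "nL (T x - z) \<le> d"
      using M(3)[OF x] N(3)[OF x] by blast
    have eq: "(S + T) x - (y + z) = (S x - y) + (T x - z)"
      by (simp add: fun_eq_iff)
    have "nL ((S + T) x - (y + z)) \<le> nL (S x - y) + nL (T x - z)"
      unfolding eq using op_L[OF ST(1) x(1)] op_L[OF ST(2) x(1)] subsetD[OF M(2) y(1)] subsetD[OF N(2) z(1)]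
      by (intro norm_add L_diff)
    then have "nL ((S + T) x - (y + z)) \<le> c + d"
      using y(2) z(2) by linarith
    moreover have "y + z \<in> (\<lambda>(y, z). y + z) ` (M \<times> N)"
      using y(1) z(1) by (intro image_eqI[of _ _ "(y, z)"]) simp_all
    ultimately show "\<exists>w\<in>(\<lambda>(y, z). y + z) ` (M \<times> N). nL ((S + T) x - w) \<le> c + d"
      by (rule bexI)
  qed (use M N in auto)
qed

text \<open>A net of radius \<open>d\<close> for \<open>T\<close> leaves remainders in
  \<open>d\<close> times the unit ball, where the net for \<open>S\<close>, scaled by
  \<open>d\<close>, applies. Hence the centres d y + S z.\<close>

lemma covered_comp:
  assumes "covered S c" "covered T d" "d > 0" and ST: "bounded_op L nL S" "bounded_op L nL T"
  shows "covered (S \<circ> T) (c * d)"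
proof -
  obtain M where M: "finite M" "M \<subseteq> L" "\<And>x. x \<in> L \<Longrightarrow> nL x \<le> 1 \<Longrightarrow> \<exists>y\<in>M. nL (S x - y) \<le> c"
    using coveredE[OF assms(1)] by metis
  obtain N where N: "finite N" "N \<subseteq> L" "\<And>x. x \<in> L \<Longrightarrow> nL x \<le> 1 \<Longrightarrow> \<exists>y\<in>N. nL (T x - y) \<le> d"
    using coveredE[OF assms(2)] by metis
  let ?f = "\<lambda>(y, z). smul (of_real d) y + S z"
  show ?thesis
  proof (rule coveredI[of "?f ` (M \<times> N)"])
    show "?f ` (M \<times> N) \<subseteq> L"
      using M(2) N(2) op_L[OF ST(1)] by (auto intro!: L_add L_smul)
    fix x assume x: "x \<in> L" "nL x \<le> 1"
    obtain z where z: "z \<in> N" "z \<in> L" "nL (T x - z) \<le> d"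
      using N(3)[OF x] N(2) by blast
    let ?w = "smul (of_real (1 / d)) (T x - z)"
    have Tz: "T x - z \<in> L"
      using op_L[OF ST(2) x(1)] z by simp
    then have w: "?w \<in> L" "nL ?w \<le> 1"
      using z assms(3) by (simp_all add: norm_divide)
    then obtain y where y: "y \<in> M" "y \<in> L" "nL (S ?w - y) \<le> c"
      using M(2,3) by blast
    have "T x - z = smul (of_real d) ?w"
      using assms(3) by simp
    then have "S (T x) - S z = smul (of_real d) (S ?w)"
      using op_diff[OF ST(1) op_L[OF ST(2) x(1)] z(2)] op_smul[OF ST(1) w(1), of "of_real d"] by simp
    then have eq: "(S \<circ> T) x - ?f (y, z) = smul (of_real d) (S ?w - y)"
      by (simp add: fun_eq_iff algebra_simps)
    have "nL ((S \<circ> T) x - ?f (y, z)) = d * nL (S ?w - y)"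
      unfolding eq using assms(3) op_L[OF ST(1) w(1)] y(2) by (subst norm_smul) auto
    also have "\<dots> \<le> c * d"
      using y(3) assms(3) by (simp add: mult.commute)
    finally have "nL ((S \<circ> T) x - ?f (y, z)) \<le> c * d" .
    moreover have "?f (y, z) \<in> ?f ` (M \<times> N)"
      using y(1) z(1) by (intro imageI) simp
    ultimately show "\<exists>w\<in>?f ` (M \<times> N). nL ((S \<circ> T) x - w) \<le> c * d"
      by (rule bexI)
  qed (use M N in auto)
qed

lemma mnc_add:
  assumes ST: "bounded_op L nL S" "bounded_op L nL T"
  shows "mnc (S + T) \<le> mnc S + mnc T"
proof (rule mnc_le_eps)
  fix e :: real assume "e > 0"
  then have "covered S (mnc S + e / 2)" "covered T (mnc T + e / 2)"
    using ST by (auto intro: mnc_less)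
  then show "covered (S + T) (mnc S + mnc T + e)"
    using covered_add[of S "mnc S + e / 2" T "mnc T + e / 2"] ST by (simp add: algebra_simps)
qed (use ST mnc_nonneg in auto)

lemma mnc_comp:
  assumes ST: "bounded_op L nL S" "bounded_op L nL T"
  shows "mnc (S \<circ> T) \<le> mnc S * mnc T"
proof (rule tendsto_lowerbound)
  show "((\<lambda>e. (mnc S + e) * (mnc T + e)) \<longlongrightarrow> mnc S * mnc T) (at_right 0)"
    by (auto intro!: tendsto_eq_intros)
  have "mnc (S \<circ> T) \<le> (mnc S + e) * (mnc T + e)" if "e > 0" for e
    using ST mnc_nonneg that
    by (intro mnc_le covered_comp mnc_less) (auto intro!: mult_pos_pos add_nonneg_pos)
  then show "\<forall>\<^sub>F e in at_right 0. mnc (S \<circ> T) \<le> (mnc S + e) * (mnc T + e)"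
    by (auto simp: eventually_at_right_field intro: exI[of _ 1])
qed simp

lemma mnc_smul:
  assumes "bounded_op L nL T"
  shows "mnc (smul c \<circ> T) \<le> cmod c * mnc T"
proof -
  have "mnc (smul c) \<le> cmod c"
    by (rule mnc_bound) auto
  then show ?thesis
    using mnc_comp[OF bounded_smul assms, of c] mult_right_mono[OF _ mnc_nonneg[OF assms]]
    by (meson order.trans)
qed

lemma mnc_cong: "(\<And>x. x \<in> L \<Longrightarrow> S x = T x) \<Longrightarrow> mnc S = mnc T"
  unfolding mnc_Inf covered_def by simp

lemma mnc_diff:
  assumes "bounded_op L nL S" "bounded_op L nL T"
  shows "mnc (S - T) \<le> mnc S + mnc T"
proof -
  have "mnc (S - T) = mnc (S + (smul (-1) \<circ> T))"
    by (rule mnc_cong) (simp add: fun_eq_iff)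
  then show ?thesis
    using mnc_add[OF assms(1) bounded_comp[OF bounded_smul assms(2)], of "-1"] mnc_smul[OF assms(2), of "-1"]
    by simp
qed

text \<open>Equality fails in finite dimension, where the identity is compact and the value is
  0.\<close>

lemma mnc_id: "mnc id \<le> 1"
  by (rule mnc_bound) auto

text \<open>Without a finite net of radius \<open>e\<close>, points can be chosen greedily whose
  images have mutual distance more than \<open>e\<close>; such images have no convergent
  subsequence.\<close>

lemma compact_covered:
  assumes K: "compact_op L nL K" and "e > 0"
  shows "covered K e"
proof (rule ccontr)
  assume neg: "\<not> covered K e"
  let ?P = "\<lambda>f n x. x \<in> L \<and> nL x \<le> 1 \<and> (\<forall>m<n. nL (K x - K (f m)) > e)"
  have "\<exists>f. \<forall>n :: nat. ?P f n (f n)"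
  proof (rule dependent_wellorder_choice)
    fix n :: nat and f assume f: "\<And>m. m < n \<Longrightarrow> ?P f m (f m)"
    show "\<exists>x. ?P f n x"
    proof (rule ccontr)
      assume no: "\<nexists>x. ?P f n x"
      \<comment> \<open>If the choice cannot be continued, the finitely many earlier images already
        form a net.\<close>
      have "covered K e"
      proof (rule coveredI[of "K ` f ` {..<n}"])
        show "K ` f ` {..<n} \<subseteq> L"
          using f op_L[OF compact_bounded[OF K]] by blast
        show "\<exists>y\<in>K ` f ` {..<n}. nL (K x - y) \<le> e" if "x \<in> L" "nL x \<le> 1" for x
          using no that by (auto simp: not_less)
      qed auto
      with neg show False ..
    qed
  qed auto
  then obtain f where f: "\<And>n :: nat. f n \<in> L" "\<And>n. nL (f n) \<le> 1"
    and sep: "\<And>m n. m < n \<Longrightarrow> nL (K (f n) - K (f m)) > e"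
    by blast
  obtain r :: "nat \<Rightarrow> nat" and y where r: "strict_mono r" "y \<in> L" "(\<lambda>n. nL (K (f (r n)) - y)) \<longlonglongrightarrow> 0"
    by (rule compact_opE[OF K f])
  have KL: "K (f n) \<in> L" for n
    by (rule op_L[OF compact_bounded[OF K] f(1)])
  obtain N where N: "\<And>n. n \<ge> N \<Longrightarrow> norm (nL (K (f (r n)) - y) - 0) < e / 2"
    using LIMSEQ_D[OF r(3), of "e / 2"] \<open>e > 0\<close> by auto
  have "nL (K (f (r (Suc N))) - K (f (r N))) \<le> nL (K (f (r (Suc N))) - y) + nL (y - K (f (r N)))"
    using norm_triangle KL r(2) by simp
  also have "\<dots> < e / 2 + e / 2"
    using N[of N] N[of "Suc N"] norm_diff_commute[OF r(2) KL] KL r(2) by (intro add_strict_mono) auto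
  finally show False
    using sep[of "r N" "r (Suc N)"] strict_monoD[OF r(1), of N "Suc N"] by simp
qed

lemma mnc_compact: "compact_op L nL K \<Longrightarrow> mnc K = 0"
  by (intro order.antisym mnc_le_eps mnc_nonneg compact_bounded) (auto intro: compact_covered)

lemma mnc_calkin: assumes "S \<sim> T" shows "mnc S = mnc T"
proof -
  have le: "mnc S \<le> mnc T" if "S \<sim> T" for S T
  proof -
    have "mnc S = mnc (T + (S - T))"
      by (rule mnc_cong) simp
    also have "\<dots> \<le> mnc T + mnc (S - T)"
      by (rule mnc_add) (use that compact_bounded in \<open>auto simp: calkin_eq_def\<close>)
    also have "mnc (S - T) = 0"
      using that by (auto simp: calkin_eq_def intro: mnc_compact)
    finally show ?thesis by simp
  qed
  show ?thesis
    using le[OF assms] le[OF calkin_sym[OF assms]] by simp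
qed

lemma unit_ball_bound:
  assumes T: "bounded_op L nL T" and d: "\<And>x. x \<in> L \<Longrightarrow> nL x \<le> 1 \<Longrightarrow> nL (T x) \<le> d" and x: "x \<in> L"
  shows "nL (T x) \<le> d * nL x"
proof (cases "x = 0")
  case True
  then show ?thesis using op_zero[OF T] by simp
next
  case False
  then have pos: "nL x > 0"
    using norm_nonneg[OF x] norm_eq_0[OF x] by linarith
  let ?y = "smul (of_real (1 / nL x)) x"
  have "nL (T ?y) \<le> d"
    using pos x by (intro d) (auto simp: norm_divide)
  then show ?thesis
    using op_smul[OF T x] pos op_L[OF T x] by (simp add: norm_divide divide_simps)
qed

text \<open>The finitely many centres of a net of radius \<open>c < d\<close> have uniformly small
  tails, by order continuity. The slack \<open>d - c\<close> absorbs them, and truncation does not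
  enlarge the remainders.\<close>

lemma mnc_tail:
  assumes T: "bounded_op L nL T" and "mnc T < d"
  shows "\<exists>n. \<forall>x\<in>L. nL (tail n (T x)) \<le> d * nL x"
proof -
  obtain c where c: "mnc T < c" "c < d"
    using dense[OF assms(2)] by blast
  obtain M where M: "finite M" "M \<subseteq> L" "\<And>x. x \<in> L \<Longrightarrow> nL x \<le> 1 \<Longrightarrow> \<exists>y\<in>M. nL (T x - y) \<le> c"
    using coveredE[OF mnc_less[OF T c(1)]] by metis
  have "\<exists>n. \<forall>m\<ge>n. nL (tail m y) < d - c" if "y \<in> M" for y
    using tail_small[of y "d - c"] that M(2) c(2) by (metis diff_gt_0_iff_gt subsetD)
  then obtain n where n: "\<And>y m. y \<in> M \<Longrightarrow> m \<ge> n y \<Longrightarrow> nL (tail m y) < d - c"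
    by metis
  \<comment> \<open>\<open>insert 0\<close> keeps \<open>Max\<close> defined without an argument
    about \<open>M\<close>.\<close>
  define k where "k = Max (insert 0 (n ` M))"
  have k: "nL (tail k y) < d - c" if "y \<in> M" for y
    using n[OF that] M(1) that by (simp add: k_def)
  have "nL ((tail k \<circ> T) x) \<le> d * nL x" if "x \<in> L" for x
  proof (rule unit_ball_bound)
    fix x assume x: "x \<in> L" "nL x \<le> 1"
    obtain y where y: "y \<in> M" "y \<in> L" "nL (T x - y) \<le> c"
      using M(2,3) x by blast
    have Tx: "T x \<in> L"
      by (rule op_L[OF T x(1)])
    have eq: "tail k (T x) = tail k (T x - y) + tail k y"
      by (simp add: tail_def fun_eq_iff)
    have "nL (tail k (T x)) \<le> nL (tail k (T x - y)) + nL (tail k y)"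
      unfolding eq using y Tx by (intro norm_add) auto
    also have "\<dots> \<le> c + (d - c)"
      using tail_le[of "T x - y" k] y k[OF y(1)] Tx by (intro add_mono) auto
    finally show "nL ((tail k \<circ> T) x) \<le> d" by simp
  qed (simp_all only: bounded_comp[OF bounded_tail T] that)
  then show ?thesis by auto
qed

lemma mnc_le_tail:
  assumes T: "bounded_op L nL T" and "\<And>x. x \<in> L \<Longrightarrow> nL (tail n (T x)) \<le> d * nL x" "d \<ge> 0"
  shows "mnc T \<le> d"
proof -
  have "mnc T = mnc ((head n \<circ> T) + (tail n \<circ> T))"
    by (rule mnc_cong) (simp add: head_add_tail)
  also have "\<dots> \<le> mnc (head n \<circ> T) + mnc (tail n \<circ> T)"
    using T by (intro mnc_add) auto
  also have "\<dots> \<le> 0 + d"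
    using mnc_compact[OF compact_comp_right[OF compact_head T], of n] mnc_bound[of "tail n \<circ> T" d] assms(2,3)
    by simp
  finally show ?thesis by simp
qed

text \<open>Truncation and the lattice norm depend on moduli only, so a cut-off that is good for
  \<open>T\<close> is equally good for \<open>S\<close>.\<close>

lemma mnc_dominated:
  assumes S: "bounded_op L nL S" and T: "bounded_op L nL T"
    and dom: "\<And>x i. x \<in> L \<Longrightarrow> cmod (S x i) \<le> cmod (T (cabs x) i)"
  shows "mnc S \<le> mnc T"
proof (rule dense_ge)
  fix d assume d: "mnc T < d"
  obtain n where n: "\<forall>x\<in>L. nL (tail n (T x)) \<le> d * nL x"
    using mnc_tail[OF T d] by blast
  show "mnc S \<le> d"
  proof (rule mnc_le_tail[OF S])
    fix x assume x: "x \<in> L"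
    have "nL (tail n (S x)) \<le> nL (tail n (T (cabs x)))"
      using dom[OF x] by (intro solid(2) tail_L op_L[OF T] cabs_L x) (simp add: tail_def)
    also have "\<dots> \<le> d * nL x"
      using n x by (metis cabs_L)
    finally show "nL (tail n (S x)) \<le> d * nL x" .
  qed (use d mnc_nonneg[OF T] in auto)
qed

end

section \<open>The essential spectrum\<close>

context seq_space
begin

section \<open>Neumann series and invertibility modulo compact operators\<close>

lemma op_tendsto:
  assumes V: "bounded_op L nL V" and u: "\<And>n. u n \<in> L" "z \<in> L" and lim: "(\<lambda>n. nL (u n - z)) \<longlonglongrightarrow> 0"
  shows "(\<lambda>n. nL (V (u n) - V z)) \<longlonglongrightarrow> 0"
proof -
  obtain K where K: "\<And>x. x \<in> L \<Longrightarrow> nL (V x) \<le> K * nL x"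
    using op_bound[OF V] by metis
  show ?thesis
  proof (rule Lim_null_comparison)
    have "norm (nL (V (u n) - V z)) \<le> K * nL (u n - z)" for n
      using K[of "u n - z"] u by (simp add: op_diff[OF V] op_L[OF V])
    then show "\<forall>\<^sub>F n in sequentially. norm (nL (V (u n) - V z)) \<le> K * nL (u n - z)"
      by simp
    show "(\<lambda>n. K * nL (u n - z)) \<longlonglongrightarrow> 0"
      using tendsto_mult_left[OF lim, of K] by simp
  qed
qed

text \<open>The series of the powers of \<open>V\<close> is summed at each vector separately, and
  the limits define \<open>S\<close>. Norm limits are coordinatewise limits, so linearity and both
  inverse identities are inherited from the partial sums \<open>f\<close>.\<close>

lemma neumann_unit:
  assumes V: "bounded_op L nL V" and le: "\<And>x. x \<in> L \<Longrightarrow> nL (V x) \<le> p * nL x" and p: "0 \<le> p" "p < 1"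
  obtains S where "bounded_op L nL S" "\<And>x. x \<in> L \<Longrightarrow> S x - V (S x) = x" "\<And>x. x \<in> L \<Longrightarrow> S (x - V x) = x"
proof -
  have VL: "(V ^^ i) y \<in> L" if "y \<in> L" for y i
    by (rule op_L[OF bounded_funpow[OF V] that])
  have pow: "nL ((V ^^ i) y) \<le> p ^ i * nL y" if y: "y \<in> L" for y i
  proof (induction i)
    case (Suc i)
    show ?case
      using order.trans[OF le[OF VL[OF y]] mult_left_mono[OF Suc p(1)]] by (simp add: mult.assoc)
  qed simp
  define f where "f M y = (\<Sum>i<M. (V ^^ i) y)" for M y
  have fL: "f M y \<in> L" if "y \<in> L" for M y
    unfolding f_def using VL[OF that] by (intro L_sum)
  have "\<exists>z\<in>L. (\<lambda>M. nL (f M y - z)) \<longlonglongrightarrow> 0" if y: "y \<in> L" for y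
  proof (rule series_complete[OF VL[OF y]])
    have "summable (\<lambda>i. p ^ i * nL y)"
      using p by (intro summable_mult2 summable_geometric) simp
    then show "summable (\<lambda>i. nL ((V ^^ i) y))"
      by (rule summable_comparison_test') (use pow[OF y] VL[OF y] in simp)
  qed (auto simp: f_def)
  then obtain S where S: "\<And>y. y \<in> L \<Longrightarrow> S y \<in> L" "\<And>y. y \<in> L \<Longrightarrow> (\<lambda>M. nL (f M y - S y)) \<longlonglongrightarrow> 0"
    by metis
  have coord: "(\<lambda>M. f M y i) \<longlonglongrightarrow> S y i" if "y \<in> L" for y i
    by (rule norm_lim_coord[OF fL[OF that] S(1)[OF that] S(2)[OF that]])
  have Sb: "nL (S y) \<le> 1 / (1 - p) * nL y" if y: "y \<in> L" for y
  proof (rule LIMSEQ_le_const)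
    show "(\<lambda>M. 1 / (1 - p) * nL y + nL (f M y - S y)) \<longlonglongrightarrow> 1 / (1 - p) * nL y"
      using tendsto_add[OF tendsto_const S(2)[OF y]] by simp
    have "nL (S y) \<le> 1 / (1 - p) * nL y + nL (f M y - S y)" for M
    proof -
      have "nL (S y) \<le> nL (f M y) + nL (f M y - S y)"
        using norm_diff[OF fL[OF y, of M] L_diff[OF fL[OF y, of M] S(1)[OF y]]] by simp
      also have "nL (f M y) \<le> (\<Sum>i<M. p ^ i) * nL y"
        unfolding f_def sum_distrib_right by (rule order.trans[OF norm_sum sum_mono]) (use VL[OF y] pow[OF y] in auto)
      also have "(\<Sum>i<M. p ^ i) * nL y \<le> 1 / (1 - p) * nL y"
        using p norm_nonneg[OF y] by (intro mult_right_mono) (simp_all add: sum_gp_strict divide_right_mono)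
      finally show ?thesis
        by this simp_all
    qed
    then show "\<exists>N. \<forall>M\<ge>N. nL (S y) \<le> 1 / (1 - p) * nL y + nL (f M y - S y)"
      by blast
  qed
  show thesis
  proof
    show "bounded_op L nL S"
    proof (rule bounded_opI[where K = "1 / (1 - p)"])
      fix x y assume x: "x \<in> L" and y: "y \<in> L"
      show "S (x + y) = S x + S y"
      proof
        fix i
        have "f M (x + y) = f M x + f M y" for M
          using op_add[OF bounded_funpow[OF V] x y] by (simp add: f_def sum.distrib)
        then show "S (x + y) i = (S x + S y) i"
          using LIMSEQ_unique[OF coord[OF L_add[OF x y], of i]] tendsto_add[OF coord[OF x, of i] coord[OF y, of i]] by simp
      qed
    next
      fix x c assume x: "x \<in> L"
      show "S (smul c x) = smul c (S x)"
      proof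
        fix i
        have "f M (smul c x) i = c * f M x i" for M
          using op_smul[OF bounded_funpow[OF V] x] by (simp add: f_def sum_apply sum_distrib_left)
        then show "S (smul c x) i = smul c (S x) i"
          using LIMSEQ_unique[OF coord[OF L_smul[OF x], of c i]] tendsto_mult_left[OF coord[OF x, of i], of c] by simp
      qed
    qed (use S Sb in auto)
    fix x assume x: "x \<in> L"
    show "S x - V (S x) = x"
    proof
      fix i
      have "V (f M x) = (\<Sum>j<M. (V ^^ Suc j) x)" for M
        using op_sum[OF V, of "{..<M}" "\<lambda>j. (V ^^ j) x"] VL[OF x] by (simp add: f_def)
      then have "f (Suc M) x = x + V (f M x)" for M
        by (simp add: f_def sum.lessThan_Suc_shift del: sum.lessThan_Suc)
      moreover have "(\<lambda>M. x i + V (f M x) i) \<longlonglongrightarrow> x i + V (S x) i"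
        by (intro tendsto_add tendsto_const norm_lim_coord[OF _ _ op_tendsto[OF V _ _ S(2)[OF x]]]
            op_L[OF V] fL S x)
      ultimately have "(\<lambda>M. f (Suc M) x i) \<longlonglongrightarrow> x i + V (S x) i"
        by simp
      then have "S x i = x i + V (S x) i"
        using LIMSEQ_unique LIMSEQ_Suc[OF coord[OF x, of i]] by blast
      then show "(S x - V (S x)) i = x i" by simp
    qed
    have Vx: "x - V x \<in> L"
      using x op_L[OF V] by simp
    show "S (x - V x) = x"
    proof
      fix i
      \<comment> \<open>The sum telescopes, and the remainder is bounded by a multiple of
        p^M.\<close>
      have "f M (x - V x) = x - (V ^^ M) x" for M
      proof (induction M)
        case (Suc M)
        have *: "(V ^^ M) (x - V x) = (V ^^ M) x - (V ^^ Suc M) x"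
          using op_diff[OF bounded_funpow[OF V] x op_L[OF V x], of M] by (simp add: funpow_swap1)
        have "f (Suc M) (x - V x) = f M (x - V x) + (V ^^ M) (x - V x)"
          by (simp add: f_def)
        then show ?case
          unfolding Suc * by (simp only: add_diff_eq diff_add_cancel)
      qed (simp add: f_def)
      moreover have "(\<lambda>M. (V ^^ M) x i) \<longlonglongrightarrow> 0"
      proof (rule Lim_null_comparison)
        show "\<forall>\<^sub>F M in sequentially. norm ((V ^^ M) x i) \<le> p ^ M * nL x"
          using order.trans[OF coord_le[OF VL[OF x]] pow[OF x]] by (intro always_eventually allI)
        show "(\<lambda>M. p ^ M * nL x) \<longlonglongrightarrow> 0"
          using tendsto_mult_right[OF LIMSEQ_power_zero[of p], of "nL x"] p by simp
      qed
      then have "(\<lambda>M. x i - (V ^^ M) x i) \<longlonglongrightarrow> x i"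
        using tendsto_diff[OF tendsto_const[of "x i"]] by fastforce
      ultimately show "S (x - V x) i = x i"
        using LIMSEQ_unique[OF coord[OF Vx, of i]] by simp
    qed
  qed
qed

text \<open>Since w - U equals w times 1 - U/w, the unit case applies to U/w.\<close>

lemma neumann:
  assumes U: "bounded_op L nL U" and le: "\<And>x. x \<in> L \<Longrightarrow> nL (U x) \<le> q * nL x" and q: "0 \<le> q" "q < cmod w"
  obtains S where "bounded_op L nL S" "\<And>x. x \<in> L \<Longrightarrow> smul w (S x) - U (S x) = x"
    "\<And>x. x \<in> L \<Longrightarrow> S (smul w x - U x) = x"
proof -
  have w: "w \<noteq> 0"
    using q by auto
  let ?V = "smul (1 / w) \<circ> U"
  have "nL (?V x) \<le> (q / cmod w) * nL x" if "x \<in> L" for x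
    using le[OF that] op_L[OF U that] by (simp add: norm_divide divide_right_mono)
  then obtain S where S: "bounded_op L nL S" "\<And>x. x \<in> L \<Longrightarrow> S x - ?V (S x) = x" "\<And>x. x \<in> L \<Longrightarrow> S (x - ?V x) = x"
    using neumann_unit[of ?V "q / cmod w"] U q w by (auto simp: divide_simps)
  show thesis
  proof
    show "bounded_op L nL (S \<circ> smul (1 / w))"
      using S(1) by simp
    fix x assume x: "x \<in> L"
    let ?y = "S (smul (1 / w) x)"
    have "smul w ?y - U ?y = smul w (?y - ?V ?y)"
      using w by (simp add: smul_diff)
    also have "\<dots> = x"
      unfolding S(2)[OF L_smul[OF x]] using w by simp
    finally show "smul w ((S \<circ> smul (1 / w)) x) - U ((S \<circ> smul (1 / w)) x) = x"
      by simp
    have "smul (1 / w) (smul w x - U x) = x - ?V x"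
      using w by (simp add: smul_diff)
    then show "(S \<circ> smul (1 / w)) (smul w x - U x) = x"
      using S(3)[OF x] by simp
  qed
qed

text \<open>The factor \<open>p\<close> is the sum of lam^(N-1-i) T^i over i < N, the quotient in
  the factorisation of lam^N - T^N. Both orders of the product are recorded because a two-sided
  inverse modulo compacts is built from it.\<close>

lemma geometric_factor:
  assumes T: "bounded_op L nL T"
  shows "\<exists>p. bounded_op L nL p \<and> (\<forall>x\<in>L. smul lam (p x) - T (p x) = smul (lam ^ N) x - (T ^^ N) x)
    \<and> (\<forall>x\<in>L. p (smul lam x - T x) = smul (lam ^ N) x - (T ^^ N) x)"
proof (induction N)
  case 0
  show ?case
    using op_zero[OF T] by (intro exI[of _ 0] conjI ballI bounded_zero) (simp_all add: fun_eq_iff zero_fun_def)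
next
  case (Suc N)
  then obtain p where p: "bounded_op L nL p" "\<And>x. x \<in> L \<Longrightarrow> smul lam (p x) - T (p x) = smul (lam ^ N) x - (T ^^ N) x"
    "\<And>x. x \<in> L \<Longrightarrow> p (smul lam x - T x) = smul (lam ^ N) x - (T ^^ N) x"
    by blast
  note TN = bounded_funpow[OF T, of N]
  \<comment> \<open>The quotient for \<open>Suc N\<close> is lam times the quotient for
    \<open>N\<close>, plus T^N.\<close>
  show ?case
  proof (intro exI[of _ "(smul lam \<circ> p) + T ^^ N"] conjI ballI)
    show "bounded_op L nL ((smul lam \<circ> p) + T ^^ N)"
      using p(1) T by simp
    fix x assume x: "x \<in> L"
    note px = op_L[OF p(1) x] and TNx = op_L[OF TN x]
    have "T (smul lam (p x) + (T ^^ N) x) = smul lam (T (p x)) + (T ^^ Suc N) x"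
      using op_add[OF T L_smul[OF px] TNx] op_smul[OF T px] by simp
    moreover have "smul lam (smul lam (p x)) - smul lam (T (p x)) = smul lam (smul (lam ^ N) x - (T ^^ N) x)"
      using p(2)[OF x] by (metis smul_diff)
    ultimately show "smul lam (((smul lam \<circ> p) + T ^^ N) x) - T (((smul lam \<circ> p) + T ^^ N) x)
        = smul (lam ^ Suc N) x - (T ^^ Suc N) x"
      by (simp add: fun_eq_iff algebra_simps)
    have "(T ^^ N) (smul lam x - T x) = smul lam ((T ^^ N) x) - (T ^^ Suc N) x"
      using op_diff[OF TN L_smul[OF x] op_L[OF T x]] op_smul[OF TN x] by (simp add: funpow_swap1)
    then have "smul lam (p (smul lam x - T x)) + (T ^^ N) (smul lam x - T x)
        = smul lam (smul (lam ^ N) x - (T ^^ N) x) + (smul lam ((T ^^ N) x) - (T ^^ Suc N) x)"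
      by (simp only: p(3)[OF x])
    then show "((smul lam \<circ> p) + T ^^ N) (smul lam x - T x) = smul (lam ^ Suc N) x - (T ^^ Suc N) x"
      by (simp add: smul_diff)
  qed
qed

text \<open>Modulo compacts T^N equals \<open>tail n \<circ> T ^^ N\<close>, whose norm is below
  |lam|^N for a suitable n. So lam^N - T^N is invertible in the Calkin algebra, and the quotient
  \<open>p\<close> carries this over to lam - T.\<close>

lemma not_ess_spectrum:
  assumes T: "bounded_op L nL T" and less: "mnc (T ^^ N) < cmod lam ^ N"
  shows "lam \<notin> ess_spectrum L nL T"
proof -
  note TN = bounded_funpow[OF T, of N]
  obtain q where q: "mnc (T ^^ N) < q" "q < cmod (lam ^ N)"
    using dense[OF less] by (auto simp: norm_power)
  obtain n where n: "\<And>x. x \<in> L \<Longrightarrow> nL (tail n ((T ^^ N) x)) \<le> q * nL x"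
    using mnc_tail[OF TN q(1)] by metis
  let ?w = "lam ^ N" and ?U = "tail n \<circ> T ^^ N" and ?H = "head n \<circ> T ^^ N"
  have U: "bounded_op L nL ?U" and H: "bounded_op L nL ?H"
    using TN by simp_all
  have "0 \<le> q"
    using q(1) mnc_nonneg[OF TN] by simp
  then obtain S where S: "bounded_op L nL S" "\<And>x. x \<in> L \<Longrightarrow> smul ?w (S x) - ?U (S x) = x"
    "\<And>x. x \<in> L \<Longrightarrow> S (smul ?w x - ?U x) = x"
    using neumann[OF U, of q ?w] n q(2) by (metis comp_apply)
  obtain p where p: "bounded_op L nL p" "\<And>x. x \<in> L \<Longrightarrow> smul lam (p x) - T (p x) = smul ?w x - (T ^^ N) x"
    "\<And>x. x \<in> L \<Longrightarrow> p (smul lam x - T x) = smul ?w x - (T ^^ N) x"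
    using geometric_factor[OF T, of lam N] by metis
  let ?A = "smul lam - T"
  have A: "bounded_op L nL ?A"
    using T by simp
  have split: "smul ?w x - (T ^^ N) x = (smul ?w x - ?U x) - ?H x" for x
    by (simp add: fun_eq_iff head_def tail_def)
  have right: "?A \<circ> (p \<circ> S) \<sim> id"
  proof (rule calkin_eqI[of _ _ "smul (-1) \<circ> (?H \<circ> S)"])
    show "compact_op L nL (smul (-1) \<circ> (?H \<circ> S))"
      by (intro compact_smul compact_comp_right compact_head TN S)
    fix x assume x: "x \<in> L"
    show "(?A \<circ> (p \<circ> S)) x = id x + (smul (-1) \<circ> (?H \<circ> S)) x"
      using p(2)[OF op_L[OF S(1) x]] split[of "S x"] S(2)[OF x] by (simp add: fun_eq_iff)
  qed (use A p S in auto)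
  have left: "(S \<circ> p) \<circ> ?A \<sim> id"
  proof (rule calkin_eqI[of _ _ "smul (-1) \<circ> (S \<circ> ?H)"])
    show "compact_op L nL (smul (-1) \<circ> (S \<circ> ?H))"
      by (intro compact_smul compact_comp_left compact_comp_right compact_head TN S)
    fix x assume x: "x \<in> L"
    have "S (smul ?w x - (T ^^ N) x) = S (smul ?w x - ?U x) - S (?H x)"
      unfolding split by (rule op_diff[OF S(1) L_diff[OF L_smul[OF x] op_L[OF U x]] op_L[OF H x]])
    then have "S (p (smul lam x - T x)) = x - S (?H x)"
      by (simp only: p(3)[OF x] S(3)[OF x])
    then show "((S \<circ> p) \<circ> ?A) x = id x + (smul (-1) \<circ> (S \<circ> ?H)) x"
      by (simp add: fun_eq_iff)
  qed (use A p S in auto)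
  \<comment> \<open>\<open>p \<circ> S\<close> is a right inverse and \<open>S \<circ> p\<close> a
    left inverse of \<open>?A\<close> modulo compacts. By associativity they agree, so one operator
    serves on both sides.\<close>
  have XY: "S \<circ> p \<sim> p \<circ> S"
  proof -
    have "(S \<circ> p) \<circ> id \<sim> (S \<circ> p) \<circ> (?A \<circ> (p \<circ> S))"
      using p(1) S(1) by (intro calkin_comp_left calkin_sym[OF right]) simp
    also have "(S \<circ> p) \<circ> (?A \<circ> (p \<circ> S)) = ((S \<circ> p) \<circ> ?A) \<circ> (p \<circ> S)"
      by (simp only: comp_assoc)
    also have "\<dots> \<sim> id \<circ> (p \<circ> S)"
      using p(1) S(1) by (intro calkin_comp_right left) simp
    finally show ?thesis by (simp only: id_comp comp_id)
  qed
  have "(p \<circ> S) \<circ> ?A \<sim> (S \<circ> p) \<circ> ?A"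
    by (rule calkin_comp_right[OF A calkin_sym[OF XY]])
  also note left
  finally have "(p \<circ> S) \<circ> ?A \<sim> id" .
  then show ?thesis
    unfolding ess_spectrum_calkin[OF T] using right bounded_comp[OF p(1) S(1)] by blast
qed

lemma ess_spectrum_le:
  assumes T: "bounded_op L nL T" and N: "N \<ge> 1" "mnc (T ^^ N) \<le> s ^ N" "s \<ge> 0"
    and lam: "lam \<in> ess_spectrum L nL T"
  shows "cmod lam \<le> s"
proof -
  have "cmod lam ^ N \<le> s ^ N"
    using not_ess_spectrum[OF T, of N lam] lam N(2) by linarith
  then show ?thesis
    using N power_mono_iff[of "cmod lam" s N] by simp
qed

lemma ess_rad_le:
  assumes "bounded_op L nL T" "N \<ge> 1" "mnc (T ^^ N) \<le> s ^ N" "s \<ge> 0"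
  shows "ess_rad L nL T \<le> s"
  unfolding ess_rad_def using ess_spectrum_le[OF assms] assms(4) by (intro cSup_least) auto

text \<open>The spectral bound with N = 1 shows that the spectrum is bounded, so the
  \<open>Sup\<close> in the definition is a genuine supremum.\<close>

lemma ess_rad_ge:
  assumes T: "bounded_op L nL T"
  shows "0 \<le> ess_rad L nL T" "lam \<in> ess_spectrum L nL T \<Longrightarrow> cmod lam \<le> ess_rad L nL T"
proof -
  have "bdd_above (insert 0 (cmod ` ess_spectrum L nL T))"
    using ess_spectrum_le[OF T, of 1 "mnc T"] mnc_nonneg[OF T] by (auto intro!: bdd_aboveI[of _ "mnc T"])
  then show "0 \<le> ess_rad L nL T" "lam \<in> ess_spectrum L nL T \<Longrightarrow> cmod lam \<le> ess_rad L nL T"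
    unfolding ess_rad_def by (auto intro: cSup_upper)
qed

end

section \<open>The essential spectral radius of a positive operator\<close>

context seq_space
begin

text \<open>The estimate |T x| \<le> T |x| is part of the notion. For a matrix it is the triangle
  inequality for series, whereas deriving it from positivity would take a separate argument for
  complex sequences.\<close>

definition positive_op :: "(cseq \<Rightarrow> cseq) \<Rightarrow> bool" where
  "positive_op T \<longleftrightarrow> bounded_op L nL T \<and> (\<forall>x\<in>L. seq_pos x \<longrightarrow> seq_pos (T x)) \<and>
    (\<forall>x\<in>L. \<forall>i. cmod (T x i) \<le> cmod (T (cabs x) i))"

lemma
  assumes "positive_op T"
  shows positive_bounded: "bounded_op L nL T"
    and positive_pos: "x \<in> L \<Longrightarrow> seq_pos x \<Longrightarrow> seq_pos (T x)"
    and positive_abs: "x \<in> L \<Longrightarrow> cmod (T x i) \<le> cmod (T (cabs x) i)"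
  using assms unfolding positive_op_def by blast+

lemma positive_mono:
  assumes T: "positive_op T" and x: "x \<in> L" and y: "y \<in> L" "seq_pos y" and le: "\<And>i. cmod (x i) \<le> cmod (y i)"
  shows "cmod (T x i) \<le> cmod (T y i)"
proof -
  note Tb = positive_bounded[OF T]
  have d: "seq_pos (y - cabs x)"
    using y(2) le unfolding seq_pos_def by (simp add: cmod_eq_Re)
  have "T y i = T (cabs x) i + T (y - cabs x) i"
    using op_diff[OF Tb y(1) cabs_L(1)[OF x]] by simp
  moreover have "seq_pos (T (cabs x))" "seq_pos (T (y - cabs x))"
    using positive_pos[OF T] d x y(1) by simp_all
  ultimately have "cmod (T (cabs x) i) \<le> cmod (T y i)"
    unfolding seq_pos_def by (simp add: cmod_eq_Re)
  with positive_abs[OF T x, of i] show ?thesis by simp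
qed

lemma positive_funpow: "positive_op T \<Longrightarrow> positive_op (T ^^ n)"
proof (induction n)
  case (Suc n)
  note T = Suc.prems and IH = Suc.IH[OF Suc.prems]
  note b = positive_bounded[OF IH]
  have "cmod (T ((T ^^ n) x) i) \<le> cmod (T ((T ^^ n) (cabs x)) i)" if "x \<in> L" for x i
    by (rule positive_mono[OF T op_L[OF b that] op_L[OF b cabs_L(1)[OF that]]
          positive_pos[OF IH cabs_L(1)[OF that] seq_pos_cabs] positive_abs[OF IH that]])
  then show ?case
    unfolding positive_op_def
    using bounded_comp[OF positive_bounded[OF T] b] positive_pos[OF T] positive_pos[OF IH] op_L[OF b] by simp
qed (simp add: positive_op_def)

text \<open>Submultiplicativity turns a bound at one exponent into bounds at arbitrarily large
  exponents and at common multiples of several exponents.\<close>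

lemma mnc_funpow_mult:
  assumes T: "bounded_op L nL T" and le: "mnc (T ^^ N) \<le> s ^ N" and "s \<ge> 0"
  shows "mnc (T ^^ (N * q)) \<le> s ^ (N * q)"
proof (induction q)
  case 0
  show ?case using mnc_id by (simp add: id_def)
next
  case (Suc q)
  have "T ^^ (N * Suc q) = T ^^ N \<circ> T ^^ (N * q)"
    by (simp add: funpow_add)
  then have "mnc (T ^^ (N * Suc q)) \<le> mnc (T ^^ N) * mnc (T ^^ (N * q))"
    using mnc_comp T by simp
  also have "\<dots> \<le> s ^ N * s ^ (N * q)"
    using le Suc assms(3) mnc_nonneg T by (intro mult_mono) auto
  finally show ?case
    by (simp add: power_add)
qed

text \<open>The first \<open>K\<close> terms of the Neumann series of (1 - T/l)^(-1).\<close>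

definition pow_sum :: "(cseq \<Rightarrow> cseq) \<Rightarrow> real \<Rightarrow> nat \<Rightarrow> cseq \<Rightarrow> cseq" where
  "pow_sum T l K = (\<lambda>x. \<Sum>i<K. smul (of_real (inverse l ^ i)) ((T ^^ i) x))"

lemma pow_sum_0: "pow_sum T l 0 = 0"
  by (simp add: pow_sum_def zero_fun_def)

lemma pow_sum_Suc: "pow_sum T l (Suc K) = pow_sum T l K + (smul (of_real (inverse l ^ K)) \<circ> T ^^ K)"
  by (simp add: pow_sum_def fun_eq_iff)

lemma bounded_pow_sum: "bounded_op L nL T \<Longrightarrow> bounded_op L nL (pow_sum T l K)"
  by (induction K) (simp_all add: pow_sum_0 pow_sum_Suc)

lemma pow_sum_telescope:
  assumes T: "bounded_op L nL T" and x: "x \<in> L" and l: "l \<noteq> 0"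
  shows "pow_sum T l K (smul (of_real l) x - T x) = smul (of_real l) (x - smul (of_real (inverse l ^ K)) ((T ^^ K) x))"
proof (induction K)
  case (Suc K)
  have *: "(T ^^ K) (smul (of_real l) x - T x) = smul (of_real l) ((T ^^ K) x) - (T ^^ Suc K) x"
    using op_diff[OF bounded_funpow[OF T] L_smul[OF x] op_L[OF T x]] op_smul[OF bounded_funpow[OF T] x]
    by (simp add: funpow_swap1)
  have "pow_sum T l (Suc K) (smul (of_real l) x - T x) = pow_sum T l K (smul (of_real l) x - T x)
      + smul (of_real (inverse l ^ K)) ((T ^^ K) (smul (of_real l) x - T x))"
    by (simp add: pow_sum_Suc)
  also have "\<dots> = smul (of_real l) (x - smul (of_real (inverse l ^ Suc K)) ((T ^^ Suc K) x))"
    unfolding Suc * using l by (simp add: fun_eq_iff algebra_simps)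
  finally show ?case .
qed (simp add: pow_sum_0)

text \<open>Expanding the square gives the terms (T/l)^(i+j) z, and none can cancel another because
  \<open>T\<close> and \<open>z\<close> are positive. The pairs (i, n - i) account for the factor
  \<open>Suc n\<close>; \<open>n < K\<close> puts both indices in range.\<close>

lemma pow_sum_square_ge:
  assumes T: "positive_op T" and z: "z \<in> L" "seq_pos z" and l: "l > 0" and n: "n < K"
  shows "real (Suc n) * inverse l ^ n * cmod ((T ^^ n) z a) \<le> cmod (pow_sum T l K (pow_sum T l K z) a)"
proof -
  note Tb = positive_bounded[OF T]
  have zL: "(T ^^ i) z \<in> L" for i
    by (rule op_L[OF bounded_funpow[OF Tb] z(1)])
  define h where "h i = inverse l ^ i * cmod ((T ^^ i) z a)" for i
  have h: "h i \<ge> 0" for i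
    using l by (simp add: h_def)
  have "pow_sum T l K (pow_sum T l K z) a
      = (\<Sum>i<K. \<Sum>j<K. of_real (inverse l ^ i) * (of_real (inverse l ^ j) * (T ^^ i) ((T ^^ j) z) a))"
  proof -
    have "(T ^^ i) (pow_sum T l K z) = (\<Sum>j<K. smul (of_real (inverse l ^ j)) ((T ^^ i) ((T ^^ j) z)))" for i
    proof -
      have "(T ^^ i) (pow_sum T l K z) = (\<Sum>j<K. (T ^^ i) (smul (of_real (inverse l ^ j)) ((T ^^ j) z)))"
        unfolding pow_sum_def by (intro op_sum[OF bounded_funpow[OF Tb]] L_smul zL)
      then show ?thesis
        by (simp only: op_smul[OF bounded_funpow[OF Tb] zL])
    qed
    moreover have "pow_sum T l K y a = (\<Sum>i<K. of_real (inverse l ^ i) * (T ^^ i) y a)" for y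
      by (simp add: pow_sum_def sum_apply)
    ultimately show ?thesis
      by (simp add: sum_apply sum_distrib_left)
  qed
  also have "\<dots> = (\<Sum>i<K. \<Sum>j<K. complex_of_real (h (i + j)))"
  proof (intro sum.cong refl)
    fix i j
    have "(T ^^ i) ((T ^^ j) z) = (T ^^ (i + j)) z"
      by (simp add: funpow_add)
    moreover have "(T ^^ (i + j)) z a = complex_of_real (cmod ((T ^^ (i + j)) z a))"
      by (rule seq_posD[OF positive_pos[OF positive_funpow[OF T] z]])
    ultimately have "(T ^^ i) ((T ^^ j) z) a = complex_of_real (cmod ((T ^^ (i + j)) z a))"
      by metis
    then show "of_real (inverse l ^ i) * (of_real (inverse l ^ j) * (T ^^ i) ((T ^^ j) z) a) = complex_of_real (h (i + j))"
      by (simp only: h_def power_add of_real_mult mult.assoc)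
  qed
  also have "\<dots> = complex_of_real (\<Sum>i<K. \<Sum>j<K. h (i + j))"
    by simp
  finally have eq: "cmod (pow_sum T l K (pow_sum T l K z) a) = (\<Sum>i<K. \<Sum>j<K. h (i + j))"
    using h by (simp only: norm_of_real) (simp add: sum_nonneg)
  have "real (Suc n) * h n = (\<Sum>i<Suc n. h (i + (n - i)))"
    by simp
  also have "\<dots> \<le> (\<Sum>i<Suc n. \<Sum>j<K. h (i + j))"
  proof (rule sum_mono)
    fix i assume "i \<in> {..<Suc n}"
    then show "h (i + (n - i)) \<le> (\<Sum>j<K. h (i + j))"
      using n h by (intro member_le_sum[of "n - i" "{..<K}" "\<lambda>j. h (i + j)"]) auto
  qed
  also have "\<dots> \<le> (\<Sum>i<K. \<Sum>j<K. h (i + j))"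
    using n h by (intro sum_mono2) (auto intro: sum_nonneg)
  finally show ?thesis
    unfolding eq by (simp add: h_def mult.assoc)
qed

text \<open>Write p for the partial sum and r - T = (l - T) - (l - r). As S is a right inverse of r
  - T modulo compacts, telescoping shows p to be congruent to l (1 - (T/l)^K) S - (l - r) p S. The
  first term contributes at most 2 l \<gamma>(S) by the bound on T^K, the second at most
  \<gamma>(p)/2. Absorbing the latter on the left gives the constant 4.\<close>

lemma mnc_pow_sum_le:
  assumes T: "bounded_op L nL T" and S: "bounded_op L nL S" "(smul (of_real r) - T) \<circ> S \<sim> id"
    and l: "l > 0" "\<bar>l - r\<bar> * mnc S \<le> 1 / 2" and K: "mnc (T ^^ K) \<le> l ^ K"
  shows "mnc (pow_sum T l K) \<le> 4 * l * mnc S"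
proof -
  let ?p = "pow_sum T l K" and ?E = "smul (of_real (inverse l ^ K)) \<circ> T ^^ K"
  let ?F = "smul (of_real l) \<circ> ((id - ?E) \<circ> S)" and ?G = "smul (of_real (l - r)) \<circ> (?p \<circ> S)"
  have p: "bounded_op L nL ?p" and E: "bounded_op L nL ?E"
    using T by (simp_all add: bounded_pow_sum)
  have "?p \<circ> id \<sim> ?p \<circ> ((smul (of_real r) - T) \<circ> S)"
    by (rule calkin_comp_left[OF p calkin_sym[OF S(2)]])
  also have "\<dots> \<sim> ?F - ?G"
  proof (rule calkin_eq_on)
    fix x assume "x \<in> L"
    then have y: "S x \<in> L" by (rule op_L[OF S(1)])
    have "smul (of_real r) (S x) - T (S x) = (smul (of_real l) (S x) - T (S x)) - smul (of_real (l - r)) (S x)"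
      by (simp add: fun_eq_iff algebra_simps)
    then have "?p (smul (of_real r) (S x) - T (S x))
        = ?p (smul (of_real l) (S x) - T (S x)) - smul (of_real (l - r)) (?p (S x))"
      by (simp only: op_diff[OF p L_diff[OF L_smul[OF y] op_L[OF T y]] L_smul[OF y]] op_smul[OF p y])
    then show "(?p \<circ> ((smul (of_real r) - T) \<circ> S)) x = (?F - ?G) x"
      using pow_sum_telescope[OF T y, of l K] l(1) by simp
  qed (use p E S in auto)
  finally have "mnc ?p = mnc (?F - ?G)"
    by (simp add: mnc_calkin)
  also have "\<dots> \<le> mnc ?F + mnc ?G"
    using p E S by (intro mnc_diff) auto
  also have "mnc ?F \<le> l * (2 * mnc S)"
  proof -
    have "mnc ?E \<le> inverse l ^ K * l ^ K"
      using order.trans[OF mnc_smul[OF bounded_funpow[OF T], of "of_real (inverse l ^ K)" K] mult_left_mono[OF K]] l(1)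
      by (simp add: norm_power norm_inverse)
    also have "\<dots> = 1"
      using l(1) by (simp flip: power_mult_distrib)
    finally have "mnc (id - ?E) \<le> 2"
      using mnc_diff[OF bounded_id E] mnc_id by simp
    then have le: "mnc ((id - ?E) \<circ> S) \<le> 2 * mnc S"
      using mnc_comp[of "id - ?E" S] mult_right_mono[OF _ mnc_nonneg[OF S(1)], of "mnc (id - ?E)" 2] E S(1) by simp
    have "mnc ?F \<le> l * mnc ((id - ?E) \<circ> S)"
      using mnc_smul[of "(id - ?E) \<circ> S" "of_real l"] E S(1) l(1) by simp
    also have "\<dots> \<le> l * (2 * mnc S)"
      using le l(1) by (intro mult_left_mono) auto
    finally show ?thesis .
  qed
  also have "mnc ?G \<le> mnc ?p / 2"
  proof -
    have "mnc ?G \<le> cmod (of_real (l - r)) * mnc (?p \<circ> S)"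
      by (rule mnc_smul[OF bounded_comp[OF p S(1)]])
    also have "\<dots> \<le> \<bar>l - r\<bar> * (mnc ?p * mnc S)"
      unfolding norm_of_real by (rule mult_left_mono[OF mnc_comp[OF p S(1)]]) simp
    also have "\<dots> = (\<bar>l - r\<bar> * mnc S) * mnc ?p"
      by simp
    also have "\<dots> \<le> 1 / 2 * mnc ?p"
      by (rule mult_right_mono[OF l(2) mnc_nonneg[OF p]])
    finally show ?thesis by simp
  qed
  finally show ?thesis by simp
qed

text \<open>Pringsheim: a power series with nonnegative coefficients is singular at its radius of convergence.
  If the resolvent had no singularity at \<open>r\<close>, the partial sums \<open>p\<close> of the series would be bounded near \<open>r\<close>,
  and the square of \<open>p\<close> contains \<open>n + 1\<close> copies of the \<open>n\<close>-th term.\<close>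
lemma mnc_pow_half:
  assumes T: "positive_op T" and r: "r > 0" "of_real r \<notin> ess_spectrum L nL T"
    and above: "\<And>l. l > r \<Longrightarrow> \<exists>N\<ge>1. mnc (T ^^ N) \<le> l ^ N"
  shows "\<exists>n\<ge>1. mnc (T ^^ n) \<le> r ^ n / 2"
proof -
  note Tb = positive_bounded[OF T]
  obtain S where S: "bounded_op L nL S" "(smul (of_real r) - T) \<circ> S \<sim> id"
    using r(2) unfolding ess_spectrum_calkin[OF Tb] by blast
  \<comment> \<open>A bound for \<gamma> of the partial sums that depends neither on
    \<open>l\<close> nor on \<open>K\<close>, so that \<open>n\<close> can be fixed before
    them.\<close>
  define M where "M = 4 * (r + 1) * mnc S"
  obtain n where n: "real n > 4 * M\<^sup>2"
    using reals_Archimedean2 by blast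
  then have n1: "n \<ge> 1"
    by (cases n) auto
  \<comment> \<open>\<open>l\<close> is chosen after \<open>n\<close>: close enough to
    \<open>r\<close> for the absorption argument and for l^n < 2 r^n.\<close>
  have "\<forall>\<^sub>F l in at_right r. \<bar>l - r\<bar> * mnc S < 1 / 2 \<and> l < r + 1 \<and> l ^ n < 2 * r ^ n \<and> r < l"
  proof (intro eventually_conj)
    have "((\<lambda>l. \<bar>l - r\<bar> * mnc S) \<longlongrightarrow> 0) (at_right r)"
      by (auto intro!: tendsto_eq_intros)
    then show "\<forall>\<^sub>F l in at_right r. \<bar>l - r\<bar> * mnc S < 1 / 2"
      by (rule order_tendstoD) simp
    have "((\<lambda>l. l) \<longlongrightarrow> r) (at_right r)"
      by (rule tendsto_ident_at)
    then show "\<forall>\<^sub>F l in at_right r. l < r + 1"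
      by (rule order_tendstoD) simp
    have "((\<lambda>l. l ^ n) \<longlongrightarrow> r ^ n) (at_right r)"
      by (intro tendsto_intros)
    then show "\<forall>\<^sub>F l in at_right r. l ^ n < 2 * r ^ n"
      by (rule order_tendstoD) (use r in simp)
    show "\<forall>\<^sub>F l in at_right r. r < l"
      by (simp add: eventually_at_right_less)
  qed
  then obtain l where l: "\<bar>l - r\<bar> * mnc S < 1 / 2" "l < r + 1" "l ^ n < 2 * r ^ n" "r < l"
    using eventually_happens[of _ "at_right r"] by force
  then have l0: "l > 0"
    using r(1) by simp
  obtain N where N: "N \<ge> 1" "mnc (T ^^ N) \<le> l ^ N"
    using above[OF l(4)] by blast
  \<comment> \<open>A multiple of \<open>N\<close>, so that \<gamma>(T^K) \<le> l^K is inherited,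
    and larger than \<open>n\<close>.\<close>
  define K where "K = N * Suc n"
  have K: "mnc (T ^^ K) \<le> l ^ K" "n < K"
    using mnc_funpow_mult[OF Tb N(2), of "Suc n"] l0 N(1) mult_le_mono1[of 1 N "Suc n"] by (simp_all add: K_def)
  let ?p = "pow_sum T l K"
  have p: "bounded_op L nL ?p"
    by (rule bounded_pow_sum[OF Tb])
  have "mnc ?p \<le> 4 * l * mnc S"
    using mnc_pow_sum_le[OF Tb S l0 _ K(1)] l(1) by simp
  also have "\<dots> \<le> M"
    unfolding M_def using l(2) mnc_nonneg[OF S(1)] by (intro mult_right_mono) auto
  finally have pM: "mnc ?p \<le> M" .
  let ?c = "real (Suc n) * inverse l ^ n"
  have c: "?c > 0"
    using l0 by simp
  have "mnc (smul (of_real ?c) \<circ> T ^^ n) \<le> mnc (?p \<circ> ?p)"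
  proof (rule mnc_dominated)
    fix x i assume x: "x \<in> L"
    have "cmod ((smul (of_real ?c) \<circ> T ^^ n) x i) = ?c * cmod ((T ^^ n) x i)"
      using c by (simp only: comp_apply smul_apply norm_mult norm_of_real abs_of_pos)
    also have "\<dots> \<le> ?c * cmod ((T ^^ n) (cabs x) i)"
      using positive_abs[OF positive_funpow[OF T] x] c by (intro mult_left_mono) auto
    also have "\<dots> \<le> cmod ((?p \<circ> ?p) (cabs x) i)"
      using pow_sum_square_ge[OF T cabs_L(1)[OF x] seq_pos_cabs l0 K(2)] by simp
    finally show "cmod ((smul (of_real ?c) \<circ> T ^^ n) x i) \<le> cmod ((?p \<circ> ?p) (cabs x) i)" .
  qed (use p Tb in auto)
  also have "\<dots> \<le> mnc ?p * mnc ?p"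
    by (rule mnc_comp[OF p p])
  also have "\<dots> \<le> M\<^sup>2"
    unfolding power2_eq_square using pM mnc_nonneg[OF p] by (intro mult_mono) auto
  finally have sq: "mnc (smul (of_real ?c) \<circ> T ^^ n) \<le> M\<^sup>2" .
  have inv: "of_real (inverse ?c) * of_real ?c = (1 :: complex)"
    unfolding of_real_mult[symmetric] left_inverse[OF less_imp_neq[OF c, symmetric]] by (rule of_real_1)
  have "mnc (T ^^ n) = mnc (smul (of_real (inverse ?c)) \<circ> (smul (of_real ?c) \<circ> T ^^ n))"
    using inv by (intro mnc_cong) (simp only: comp_apply smul_simps)
  also have "\<dots> \<le> inverse ?c * mnc (smul (of_real ?c) \<circ> T ^^ n)"
    using mnc_smul[OF bounded_comp[OF bounded_smul bounded_funpow[OF Tb]], of "of_real (inverse ?c)" "of_real ?c" n] c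
    by (simp only: norm_of_real abs_of_pos positive_imp_inverse_positive)
  also have "\<dots> \<le> inverse ?c * M\<^sup>2"
    using sq c by (intro mult_left_mono less_imp_le[OF positive_imp_inverse_positive])
  \<comment> \<open>The choice of \<open>n\<close> makes M^2 at most a quarter of
    \<open>Suc n\<close>; this yields l^n / 4, and l^n < 2 r^n turns it into r^n / 2.\<close>
  also have "\<dots> \<le> inverse ?c * (real (Suc n) / 4)"
    using n by (intro mult_left_mono less_imp_le[OF positive_imp_inverse_positive[OF c]]) simp
  also have "\<dots> = l ^ n / 4"
    using l0 by (simp add: field_simps)
  also have "\<dots> \<le> r ^ n / 2"
    using l(3) by simp
  finally show ?thesis
    using n1 by blast
qed

text \<open>The infimum \<open>r\<close> of the set \<open>G\<close> of admissible bounds plays the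
  role of the limit of the N-th roots of \<gamma>(T^N). If no exponent worked for \<open>s\<close>,
  then \<open>r\<close> would be at least \<open>s\<close>, hence outside the essential spectrum,
  and the gain of 1/2 in \<open>mnc_pow_half\<close> would produce an admissible bound below
  \<open>r\<close>.\<close>

lemma ess_rad_mnc:
  assumes T: "positive_op T" and s: "s > ess_rad L nL T"
  shows "\<exists>N\<ge>1. mnc (T ^^ N) \<le> s ^ N"
proof (rule ccontr)
  assume neg: "\<not> ?thesis"
  note Tb = positive_bounded[OF T]
  have s0: "s > 0"
    using s ess_rad_ge(1)[OF Tb] by simp
  define G where "G = {l. l > 0 \<and> (\<exists>N\<ge>1. mnc (T ^^ N) \<le> l ^ N)}"
  have up: "l \<in> G" if "g \<in> G" "g \<le> l" for g l
  proof -
    have "g > 0 \<and> (\<exists>N\<ge>1. mnc (T ^^ N) \<le> g ^ N)"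
      using that(1) by (simp only: G_def mem_Collect_eq)
    then obtain N where N: "N \<ge> 1" "mnc (T ^^ N) \<le> g ^ N" "g > 0"
      by metis
    then have "mnc (T ^^ N) \<le> l ^ N"
      using power_mono[OF that(2), of N] by simp
    then show ?thesis
      using N that(2) by (auto simp: G_def)
  qed
  have lower: "s \<le> g" if "g \<in> G" for g
    using up[OF that, of s] neg s0 by (force simp: G_def)
  have ne: "G \<noteq> {}"
    using mnc_nonneg[OF Tb] by (auto simp: G_def intro!: exI[of _ "mnc T + 1"] exI[of _ "1::nat"])
  define r where "r = Inf G"
  have r: "s \<le> r"
    unfolding r_def using ne lower by (rule cInf_greatest)
  have "\<exists>n\<ge>1. mnc (T ^^ n) \<le> r ^ n / 2"
  proof (rule mnc_pow_half[OF T])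
    show "of_real r \<notin> ess_spectrum L nL T"
      using ess_rad_ge(2)[OF Tb, of "of_real r"] r s s0 by auto
    fix l assume "l > r"
    then obtain g where "g \<in> G" "g < l"
      using cInf_lessD[OF ne] r_def by blast
    then have "l \<in> G"
      using up by auto
    then show "\<exists>N\<ge>1. mnc (T ^^ N) \<le> l ^ N"
      by (simp add: G_def)
  qed (use r s0 in auto)
  then obtain n where n: "n \<ge> 1" "mnc (T ^^ n) \<le> r ^ n / 2"
    by blast
  \<comment> \<open>Chosen with t^n = r^n / 2; the factor 1/2 makes \<open>t\<close> strictly
    smaller than \<open>r\<close>.\<close>
  define t where "t = r * root n (1 / 2)"
  have "t ^ n = r ^ n / 2"
    using n(1) by (simp add: t_def power_mult_distrib real_root_pow_pos2)
  moreover have "t > 0" "t < r"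
    using n(1) r s0 by (simp_all add: t_def)
  ultimately have "t \<in> G"
    using n by (auto simp: G_def)
  then have "r \<le> t"
    unfolding r_def using lower by (intro cInf_lower bdd_belowI)
  with \<open>t < r\<close> show False by simp
qed

end

section \<open>Positive matrices\<close>

text \<open>Let s be the sum of the exponents. As 0 \<le> y \<le> 1 and s \<ge> 1, replacing each
  exponent \<alpha> by \<alpha>/s can only increase the factors, and the new exponents add up to 1.
  The rest is weighted AM-GM.\<close>

lemma prod_powr_le_sum:
  fixes y \<alpha> :: "'a \<Rightarrow> real"
  assumes J: "finite J" and y: "\<And>j. j \<in> J \<Longrightarrow> 0 \<le> y j" "\<And>j. j \<in> J \<Longrightarrow> y j \<le> 1"
    and \<alpha>: "\<And>j. j \<in> J \<Longrightarrow> 0 < \<alpha> j" "1 \<le> sum \<alpha> J"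
  shows "(\<Prod>j\<in>J. y j powr \<alpha> j) \<le> (\<Sum>j\<in>J. \<alpha> j / sum \<alpha> J * y j)"
proof -
  define s where "s = sum \<alpha> J"
  define t where "t = (\<Sum>j\<in>J. \<alpha> j / s * y j)"
  have s: "s \<ge> 1"
    using \<alpha> by (simp add: s_def)
  have t0: "t \<ge> 0"
    unfolding t_def using y \<alpha> s by (intro sum_nonneg mult_nonneg_nonneg divide_nonneg_nonneg) (auto simp: less_imp_le)
  have "(\<Prod>j\<in>J. y j powr \<alpha> j) \<le> t"
  proof (cases "\<exists>j\<in>J. y j = 0")
    case True
    then show ?thesis using t0 J by (simp add: prod_zero)
  next
    case False
    then have ypos: "y j > 0" if "j \<in> J" for j
      using y that by (metis less_eq_real_def)
    have J0: "J \<noteq> {}"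
      using \<alpha>(2) by auto
    have tpos: "t > 0"
      unfolding t_def using ypos \<alpha>(1) s J J0 by (intro sum_pos mult_pos_pos divide_pos_pos) auto
    \<comment> \<open>AM-GM by ln u \<le> u - 1 at u = y/t, where \<open>t\<close> is the weighted
      mean: the exponents (\<alpha>/s)(y/t - 1) add up to 0, and the powers of \<open>t\<close>
      multiply to \<open>t\<close>.\<close>
    have "(\<Prod>j\<in>J. y j powr \<alpha> j) \<le> (\<Prod>j\<in>J. t powr (\<alpha> j / s) * exp (\<alpha> j / s * (y j / t - 1)))"
    proof (rule prod_mono, rule conjI)
      fix j assume j: "j \<in> J"
      have "y j powr \<alpha> j \<le> y j powr (\<alpha> j / s)"
        using ypos[OF j] y(2)[OF j] \<alpha>(1)[OF j] s
        by (intro powr_mono') (auto simp: divide_le_eq)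
      also have "\<dots> = t powr (\<alpha> j / s) * (y j / t) powr (\<alpha> j / s)"
        using ypos[OF j] tpos by (simp flip: powr_mult)
      also have "(y j / t) powr (\<alpha> j / s) = exp (\<alpha> j / s * ln (y j / t))"
        using ypos[OF j] tpos by (simp add: powr_def)
      also have "\<dots> \<le> exp (\<alpha> j / s * (y j / t - 1))"
        using ypos[OF j] tpos \<alpha>(1)[OF j] s ln_le_minus_one[of "y j / t"]
        by (simp add: divide_right_mono mult_left_mono)
      finally show "y j powr \<alpha> j \<le> t powr (\<alpha> j / s) * exp (\<alpha> j / s * (y j / t - 1))"
        by (simp add: mult_left_mono)
    qed simp
    also have "\<dots> = t powr (\<Sum>j\<in>J. \<alpha> j / s) * exp (\<Sum>j\<in>J. \<alpha> j / s * (y j / t - 1))"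
      using J tpos by (simp add: prod.distrib exp_sum powr_sum)
    also have "(\<Sum>j\<in>J. \<alpha> j / s) = 1"
      using s by (simp add: s_def flip: sum_divide_distrib)
    also have "(\<Sum>j\<in>J. \<alpha> j / s * (y j / t - 1)) = (\<Sum>j\<in>J. \<alpha> j / s * y j) / t - (\<Sum>j\<in>J. \<alpha> j / s)"
      by (simp add: right_diff_distrib sum_subtractf sum_divide_distrib)
    also have "(\<Sum>j\<in>J. \<alpha> j / s * y j) = t"
      by (simp add: t_def)
    also have "t / t - (\<Sum>j\<in>J. \<alpha> j / s) = 0"
      using s tpos by (simp add: s_def flip: sum_divide_distrib)
    finally show ?thesis
      using tpos by simp
  qed
  then show ?thesis by (simp add: t_def s_def)
qed

text \<open>Division by the upper bounds \<open>N\<close> reduces to numbers in [0, 1]. The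
  resulting majorant is linear in \<open>c\<close>, so it passes through series and
  operators.\<close>

lemma prod_powr_le_weighted_sum:
  fixes c N \<alpha> :: "'a \<Rightarrow> real"
  assumes "finite J" "\<And>j. j \<in> J \<Longrightarrow> 0 < N j" "\<And>j. j \<in> J \<Longrightarrow> 0 \<le> c j" "\<And>j. j \<in> J \<Longrightarrow> c j \<le> N j"
    and "\<And>j. j \<in> J \<Longrightarrow> 0 < \<alpha> j" "1 \<le> sum \<alpha> J"
  shows "(\<Prod>j\<in>J. c j powr \<alpha> j) \<le> (\<Sum>j\<in>J. (\<Prod>j\<in>J. N j powr \<alpha> j) * (\<alpha> j / sum \<alpha> J) / N j * c j)"
proof -
  have "(\<Prod>j\<in>J. c j powr \<alpha> j) = (\<Prod>j\<in>J. N j powr \<alpha> j) * (\<Prod>j\<in>J. (c j / N j) powr \<alpha> j)"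
    unfolding prod.distrib[symmetric]
  proof (rule prod.cong)
    fix j assume "j \<in> J"
    then have "0 < N j" "0 \<le> c j" using assms by auto
    then show "c j powr \<alpha> j = N j powr \<alpha> j * (c j / N j) powr \<alpha> j"
      by (simp add: powr_divide)
  qed simp
  also have "\<dots> \<le> (\<Prod>j\<in>J. N j powr \<alpha> j) * (\<Sum>j\<in>J. \<alpha> j / sum \<alpha> J * (c j / N j))"
    using assms by (intro mult_left_mono prod_powr_le_sum prod_nonneg) (auto simp: less_imp_le)
  also have "\<dots> = (\<Sum>j\<in>J. (\<Prod>j\<in>J. N j powr \<alpha> j) * (\<alpha> j / sum \<alpha> J) / N j * c j)"
    by (simp add: sum_distrib_left mult.assoc)
  finally show ?thesis .
qed

text \<open>At c = N the linear majorant takes the value P of the product itself, so the detour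
  through it costs nothing in the constants.\<close>

lemma sum_weights:
  fixes N \<alpha> :: "'a \<Rightarrow> real"
  assumes "\<And>j. j \<in> J \<Longrightarrow> N j \<noteq> 0" "1 \<le> sum \<alpha> J"
  shows "(\<Sum>j\<in>J. P * (\<alpha> j / sum \<alpha> J) / N j * N j) = P"
proof -
  have "(\<Sum>j\<in>J. P * (\<alpha> j / sum \<alpha> J) / N j * N j) = (\<Sum>j\<in>J. P * (\<alpha> j / sum \<alpha> J))"
    using assms(1) by (intro sum.cong) auto
  also have "\<dots> = P"
    using assms(2) by (simp flip: sum_distrib_left sum_divide_distrib)
  finally show ?thesis .
qed

text \<open>A nonnegative term is at most the sum of its series, so the linear majorant with the
  sums as upper bounds applies termwise. Its own series adds up to exactly the product on the
  right.\<close>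

lemma holder_sums:
  fixes c :: "'a \<Rightarrow> nat \<Rightarrow> real"
  assumes J: "finite J" and c: "\<And>j l. j \<in> J \<Longrightarrow> 0 \<le> c j l" "\<And>j. j \<in> J \<Longrightarrow> c j sums s j"
    and \<alpha>: "\<And>j. j \<in> J \<Longrightarrow> 0 < \<alpha> j" "1 \<le> sum \<alpha> J"
  shows "summable (\<lambda>l. \<Prod>j\<in>J. c j l powr \<alpha> j)" "(\<Sum>l. \<Prod>j\<in>J. c j l powr \<alpha> j) \<le> (\<Prod>j\<in>J. s j powr \<alpha> j)"
proof -
  have le: "c j l \<le> s j" if "j \<in> J" for j l
    using sum_le_suminf[OF sums_summable[OF c(2)[OF that]], of "{l}"] c(1)[OF that] sums_unique[OF c(2)[OF that]] by simp
  have *: "summable (\<lambda>l. \<Prod>j\<in>J. c j l powr \<alpha> j) \<and> (\<Sum>l. \<Prod>j\<in>J. c j l powr \<alpha> j) \<le> (\<Prod>j\<in>J. s j powr \<alpha> j)"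
  \<comment> \<open>The majorant divides by the sums; if one of them is 0, all products
    vanish.\<close>
  proof (cases "\<exists>j\<in>J. s j = 0")
    case True
    then obtain j where j: "j \<in> J" "s j = 0" by blast
    then have "c j l = 0" for l
      using le[OF j(1), of l] c(1)[OF j(1), of l] by simp
    then have "(\<Prod>j\<in>J. c j l powr \<alpha> j) = 0" for l
      using J j by (intro prod_zero) (auto intro: bexI[of _ j])
    then show ?thesis
      by (simp add: prod_nonneg)
  next
    case False
    then have s: "s j > 0" if "j \<in> J" for j
      using le[OF that, of 0] c(1)[OF that, of 0] that by (metis order.trans less_eq_real_def)
    define P where "P = (\<Prod>j\<in>J. s j powr \<alpha> j)"
    let ?g = "\<lambda>l. \<Sum>j\<in>J. P * (\<alpha> j / sum \<alpha> J) / s j * c j l"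
    have g: "?g sums (\<Sum>j\<in>J. P * (\<alpha> j / sum \<alpha> J) / s j * s j)"
      using c(2) by (intro sums_sum sums_mult) auto
    have sum: "(\<Sum>j\<in>J. P * (\<alpha> j / sum \<alpha> J) / s j * s j) = P"
      using s \<alpha>(2) by (intro sum_weights) (auto simp: less_imp_neq[symmetric])
    have dom: "(\<Prod>j\<in>J. c j l powr \<alpha> j) \<le> ?g l" for l
      unfolding P_def using J s c(1) le \<alpha> by (intro prod_powr_le_weighted_sum) auto
    have summ: "summable (\<lambda>l. \<Prod>j\<in>J. c j l powr \<alpha> j)"
      by (rule summable_comparison_test'[OF sums_summable[OF g]]) (use dom in \<open>simp add: prod_nonneg\<close>)
    have "(\<Sum>l. \<Prod>j\<in>J. c j l powr \<alpha> j) \<le> (\<Sum>l. ?g l)"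
      by (rule suminf_le[OF dom summ sums_summable[OF g]])
    then show ?thesis
      using summ sums_unique[OF g] sum by (simp add: P_def)
  qed
  then show "summable (\<lambda>l. \<Prod>j\<in>J. c j l powr \<alpha> j)" "(\<Sum>l. \<Prod>j\<in>J. c j l powr \<alpha> j) \<le> (\<Prod>j\<in>J. s j powr \<alpha> j)"
    by auto
qed

section \<open>Nonnegative matrices as positive bounded operators\<close>

context seq_space
begin

definition pos_matrix :: "rmat \<Rightarrow> bool" where
  "pos_matrix a \<longleftrightarrow> (\<forall>i\<in>R. \<forall>j\<in>R. 0 \<le> a i j) \<and> defines_operator R L a"

lemma pos_matrix_nonneg: "pos_matrix a \<Longrightarrow> i \<in> R \<Longrightarrow> j \<in> R \<Longrightarrow> 0 \<le> a i j"
  and pos_matrix_op: "pos_matrix a \<Longrightarrow> defines_operator R L a"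
  by (simp_all add: pos_matrix_def)

lemma matop_outside: "i \<notin> R \<Longrightarrow> matop R a x i = 0"
  by (simp add: matop_def)

lemma matop_L: "defines_operator R L a \<Longrightarrow> x \<in> L \<Longrightarrow> matop R a x \<in> L"
  by (simp add: defines_operator_def)

lemma matop_summable:
  assumes "defines_operator R L a" "x \<in> L" "i \<in> R"
  shows "summable (\<lambda>j. cmod (if j \<in> R then complex_of_real (a i j) * x j else 0))"
proof -
  have "summable (\<lambda>j. if j \<in> R then cmod (complex_of_real (a i j) * x j) else 0)"
    using assms by (simp add: defines_operator_def)
  then show ?thesis
    by (rule summable_cong[THEN iffD1, rotated]) (simp add: norm_mult)
qed

lemma matop_sums:
  assumes "defines_operator R L a" "x \<in> L" "i \<in> R"
  shows "(\<lambda>j. if j \<in> R then complex_of_real (a i j) * x j else 0) sums matop R a x i"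
  using summable_sums[OF summable_norm_cancel[OF matop_summable[OF assms]]] assms(3) by (simp add: matop_def)

lemma matop_add:
  assumes a: "defines_operator R L a" and x: "x \<in> L" and y: "y \<in> L"
  shows "matop R a (x + y) = matop R a x + matop R a y"
proof
  fix i
  show "matop R a (x + y) i = (matop R a x + matop R a y) i"
  proof (cases "i \<in> R")
    case True
    have "(\<lambda>j. if j \<in> R then complex_of_real (a i j) * (x + y) j else 0) sums (matop R a x i + matop R a y i)"
      using sums_add[OF matop_sums[OF a x True] matop_sums[OF a y True]]
      by (rule sums_cong[THEN iffD1, rotated]) (simp add: distrib_left)
    then show ?thesis
      using sums_unique2[OF matop_sums[OF a L_add[OF x y] True]] by simp
  qed (simp add: matop_outside)
qed

lemma matop_smul:
  assumes a: "defines_operator R L a" and x: "x \<in> L"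
  shows "matop R a (smul c x) = smul c (matop R a x)"
proof
  fix i
  show "matop R a (smul c x) i = smul c (matop R a x) i"
  proof (cases "i \<in> R")
    case True
    have "(\<lambda>j. if j \<in> R then complex_of_real (a i j) * smul c x j else 0) sums (c * matop R a x i)"
      using sums_mult[OF matop_sums[OF a x True], of c] by (rule sums_cong[THEN iffD1, rotated]) simp
    then show ?thesis
      using sums_unique2[OF matop_sums[OF a L_smul[OF x] True]] by simp
  qed (simp add: matop_outside)
qed

lemma matop_cabs_sums:
  assumes "defines_operator R L a" "x \<in> L" "i \<in> R"
  shows "(\<lambda>j. if j \<in> R then a i j * cmod (x j) else 0) sums Re (matop R a (cabs x) i)"
    and "Im (matop R a (cabs x) i) = 0"
proof -
  have *: "(\<lambda>j. Re (if j \<in> R then complex_of_real (a i j) * cabs x j else 0)) sums Re (matop R a (cabs x) i)"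
    "(\<lambda>j. Im (if j \<in> R then complex_of_real (a i j) * cabs x j else 0)) sums Im (matop R a (cabs x) i)"
    using matop_sums[OF assms(1) cabs_L(1)[OF assms(2)] assms(3)] unfolding sums_complex_iff by blast+
  show "(\<lambda>j. if j \<in> R then a i j * cmod (x j) else 0) sums Re (matop R a (cabs x) i)"
    using *(1) by (rule sums_cong[THEN iffD1, rotated]) simp
  have "(\<lambda>j. 0) sums Im (matop R a (cabs x) i)"
    using *(2) by (rule sums_cong[THEN iffD1, rotated]) simp
  then show "Im (matop R a (cabs x) i) = 0"
    using sums_unique2 sums_zero by blast
qed

text \<open>Only \<open>b\<close> is known to define an operator, and \<open>a\<close> is compared
  with it in the single row \<open>i\<close>. So the result can be used to show that
  \<open>a\<close> defines an operator, and for comparisons that hold in late rows only.\<close>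

lemma
  assumes b: "defines_operator R L b" and y: "y \<in> L"
    and ab: "\<And>j. j \<in> R \<Longrightarrow> \<bar>a i j\<bar> \<le> b i j" and xy: "\<And>j. cmod (x j) \<le> cmod (y j)"
  shows matop_dominated_summable: "i \<in> R \<Longrightarrow> summable (\<lambda>j. cmod (if j \<in> R then complex_of_real (a i j) * x j else 0))"
    and matop_dominated: "cmod (matop R a x i) \<le> cmod (matop R b (cabs y) i)"
proof -
  let ?f = "\<lambda>j. if j \<in> R then complex_of_real (a i j) * x j else 0"
  let ?g = "\<lambda>j. if j \<in> R then b i j * cmod (y j) else 0"
  have dom: "cmod (?f j) \<le> ?g j" for j
  proof (cases "j \<in> R")
    case True
    have "\<bar>a i j\<bar> * cmod (x j) \<le> b i j * cmod (y j)"
      using ab[OF True] by (intro mult_mono xy) auto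
    with True show ?thesis by (simp add: norm_mult)
  qed simp
  show summ: "summable (\<lambda>j. cmod (?f j))" if "i \<in> R"
    by (rule summable_comparison_test'[OF sums_summable[OF matop_cabs_sums(1)[OF b y that]]]) (use dom in simp)
  show "cmod (matop R a x i) \<le> cmod (matop R b (cabs y) i)"
  proof (cases "i \<in> R")
    case True
    note g = matop_cabs_sums(1)[OF b y True]
    have "cmod (matop R a x i) \<le> (\<Sum>j. cmod (?f j))"
      using summable_norm[OF summ[OF True]] True by (simp add: matop_def)
    also have "\<dots> \<le> (\<Sum>j. ?g j)"
      by (rule suminf_le[OF dom summ[OF True] sums_summable[OF g]])
    also have "\<dots> \<le> cmod (matop R b (cabs y) i)"
      using sums_unique[OF g] complex_Re_le_cmod by metis
    finally show ?thesis .
  qed (simp add: matop_outside)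
qed

lemma matop_pos:
  assumes a: "pos_matrix a" and x: "x \<in> L" "seq_pos x"
  shows "seq_pos (matop R a x)"
  unfolding seq_pos_def
proof
  fix i
  show "Im (matop R a x i) = 0 \<and> 0 \<le> Re (matop R a x i)"
  proof (cases "i \<in> R")
    case True
    have "0 \<le> Re (matop R a (cabs x) i)"
      using sums_le[OF _ sums_zero matop_cabs_sums(1)[OF pos_matrix_op[OF a] x(1) True]] pos_matrix_nonneg[OF a True]
      by simp
    then show ?thesis
      using matop_cabs_sums(2)[OF pos_matrix_op[OF a] x(1) True] cabs_pos[OF x(2)] by simp
  qed (simp add: matop_outside)
qed

text \<open>Automatic continuity of positive operators. If the norm of A x_n exceeds 4^n times that
  of x_n, scale |x_n| to a vector \<open>y n\<close> of norm 2^(-n). The sum \<open>z\<close> of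
  these vectors dominates each of them, so A |z| would have norm at least 4^n / 2^n = 2^n for every
  n.\<close>

lemma matop_bounded_aux:
  assumes a: "pos_matrix a"
  shows "\<exists>K. \<forall>x\<in>L. nL (matop R a x) \<le> K * nL x"
proof (rule ccontr)
  assume "\<nexists>K. \<forall>x\<in>L. nL (matop R a x) \<le> K * nL x"
  then have "\<exists>x\<in>L. nL (matop R a x) > 4 ^ n * nL x" for n :: nat
    by (meson not_le)
  then obtain x where x: "\<And>n :: nat. x n \<in> L" "\<And>n. nL (matop R a (x n)) > 4 ^ n * nL (x n)"
    by metis
  note op = pos_matrix_op[OF a]
  have "matop R a 0 = 0"
    using matop_smul[OF op L_zero, of 0] by simp
  then have "x n \<noteq> 0" for n
    using x(2)[of n] by force
  then have pos: "nL (x n) > 0" for n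
    using norm_nonneg[OF x(1)] norm_eq_0[OF x(1)] by (metis less_eq_real_def)
  define c where "c n = inverse (2 ^ n * nL (x n))" for n
  have c: "c n > 0" for n
    using pos by (simp add: c_def)
  define y where "y n = smul (of_real (c n)) (cabs (x n))" for n
  have yL: "y n \<in> L" for n
    using x(1) by (simp add: y_def)
  have ny: "nL (y n) = (1 / 2) ^ n" for n
  proof -
    have "nL (y n) = c n * nL (x n)"
      using x(1) c[of n] by (simp add: y_def)
    also have "\<dots> = (1 / 2) ^ n"
      using pos[of n] by (simp add: c_def field_simps)
    finally show ?thesis .
  qed
  have summ: "summable (\<lambda>n. nL (y n))"
    unfolding ny by (rule summable_geometric) simp
  obtain z where z: "z \<in> L" "(\<lambda>M. nL ((\<Sum>n<M. y n) - z)) \<longlonglongrightarrow> 0"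
    by (rule series_complete[OF yL summ])
  have yz: "cmod (y n i) \<le> cmod (z i)" for n i
  proof (rule LIMSEQ_le_const)
    have "(\<lambda>M. (\<Sum>n<M. y n) i) \<longlonglongrightarrow> z i"
      by (rule norm_lim_coord[OF _ z]) (intro L_sum yL)
    then show "(\<lambda>M. cmod ((\<Sum>n<M. y n) i)) \<longlonglongrightarrow> cmod (z i)"
      by (rule tendsto_norm)
    have "cmod (y n i) \<le> cmod ((\<Sum>n<M. y n) i)" if "M \<ge> Suc n" for M
    proof -
      have re: "y n i = complex_of_real (c n * cmod (x n i))" for n
        by (simp add: y_def)
      have "(\<Sum>n<M. y n) i = complex_of_real (\<Sum>n<M. c n * cmod (x n i))"
        by (simp add: sum_apply re)
      moreover have "c n * cmod (x n i) \<le> (\<Sum>n<M. c n * cmod (x n i))"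
        using that c by (intro member_le_sum) (auto simp: less_imp_le)
      ultimately show ?thesis
        using c[of n] by (simp only: re norm_of_real) simp
    qed
    then show "\<exists>N. \<forall>M\<ge>N. cmod (y n i) \<le> cmod ((\<Sum>n<M. y n) i)" by blast
  qed
  have mono: "nL (matop R a u) \<le> nL (matop R a (cabs v))" if "u \<in> L" "v \<in> L" "\<And>j. cmod (u j) \<le> cmod (v j)" for u v
  proof (rule solid(2)[OF matop_L[OF op cabs_L(1)[OF that(2)]]])
    show "cmod (matop R a u i) \<le> cmod (matop R a (cabs v) i)" for i
    proof (cases "i \<in> R")
      case True
      have "\<bar>a i j\<bar> \<le> a i j" if "j \<in> R" for j
        using pos_matrix_nonneg[OF a True that] by simp
      then show ?thesis
        by (rule matop_dominated[OF op that(2) _ that(3)])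
    qed (simp add: matop_outside)
  qed
  have "2 ^ n \<le> nL (matop R a (cabs z))" for n
  proof -
    have "2 ^ n = c n * (4 ^ n * nL (x n))"
      using pos[of n] by (simp add: c_def field_simps flip: power_mult_distrib)
    also have "\<dots> \<le> c n * nL (matop R a (cabs (x n)))"
      using order.trans[OF less_imp_le[OF x(2)] mono[OF x(1) x(1) order_refl]] c[of n]
      by (intro mult_left_mono) (simp_all add: less_imp_le)
    also have "\<dots> = nL (matop R a (y n))"
      using matop_L[OF op cabs_L(1)[OF x(1)], of n] c[of n]
      by (simp add: y_def matop_smul[OF op cabs_L(1)[OF x(1)]])
    also have "\<dots> \<le> nL (matop R a (cabs z))"
      by (rule mono[OF yL z(1) yz])
    finally show ?thesis .
  qed
  moreover obtain n where "nL (matop R a (cabs z)) < 2 ^ n"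
    using real_arch_pow[of 2] by auto
  ultimately show False
    by (meson not_le)
qed

lemma positive_matop:
  assumes a: "pos_matrix a"
  shows "positive_op (matop R a)"
proof -
  note op = pos_matrix_op[OF a]
  obtain K where K: "\<And>x. x \<in> L \<Longrightarrow> nL (matop R a x) \<le> K * nL x"
    using matop_bounded_aux[OF a] by blast
  have "bounded_op L nL (matop R a)"
    by (rule bounded_opI[OF matop_L[OF op] matop_add[OF op] matop_smul[OF op] K])
  moreover have "cmod (matop R a x i) \<le> cmod (matop R a (cabs x) i)" if "x \<in> L" for x i
  proof (cases "i \<in> R")
    case True
    then show ?thesis
      using pos_matrix_nonneg[OF a True] by (intro matop_dominated[OF op that]) auto
  qed (simp add: matop_outside)
  ultimately show ?thesis
    unfolding positive_op_def using matop_pos[OF a] by blast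
qed

lemma bounded_matop: "pos_matrix a \<Longrightarrow> bounded_op L nL (matop R a)"
  by (rule positive_bounded[OF positive_matop])

text \<open>By order continuity \<open>x\<close> is the norm limit of its heads, so a bounded
  operator is determined by its values on unit vectors.\<close>

lemma op_sums:
  assumes T: "bounded_op L nL T" and x: "x \<in> L"
  shows "(\<lambda>j. if j \<in> R then x j * T (unitvec j) i else 0) sums T x i"
proof -
  have "T (head n x) i = (\<Sum>j<n. if j \<in> R then x j * T (unitvec j) i else 0)" for n
  proof -
    have "T (head n x) = (\<Sum>j\<in>{..<n} \<inter> R. T (smul (x j) (unitvec j)))"
      unfolding head_eq_sum[OF x] by (rule op_sum[OF T]) (simp add: unitvec_L)
    also have "\<dots> = (\<Sum>j\<in>{..<n} \<inter> R. smul (x j) (T (unitvec j)))"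
      by (intro sum.cong op_smul[OF T] unitvec_L) auto
    finally show ?thesis
      by (simp add: sum_apply) (simp add: sum.inter_restrict)
  qed
  moreover have "(\<lambda>n. T (head n x) i) \<longlonglongrightarrow> T x i"
    by (rule norm_lim_coord[OF op_L[OF T head_L[OF x]] op_L[OF T x] op_tendsto[OF T head_L[OF x] x head_lim[OF x]]])
  ultimately show ?thesis
    unfolding sums_def by simp
qed

text \<open>Products, the identity and weighted sums of matrices are recognised through their
  operators: knowing the entries suffices, and no double series has to be rearranged.\<close>

lemma pos_matrix_of_op:
  assumes T: "bounded_op L nL T" and c: "\<And>i j. i \<in> R \<Longrightarrow> j \<in> R \<Longrightarrow> 0 \<le> c i j"
    and eq: "\<And>i j. i \<in> R \<Longrightarrow> j \<in> R \<Longrightarrow> T (unitvec j) i = complex_of_real (c i j)"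
  shows "pos_matrix c" "\<And>x. x \<in> L \<Longrightarrow> matop R c x = T x"
proof -
  have sums: "(\<lambda>j. if j \<in> R then complex_of_real (c i j) * x j else 0) sums T x i" if "x \<in> L" "i \<in> R" for x i
    using op_sums[OF T that(1), of i]
    by (rule sums_cong[THEN iffD1, rotated]) (simp add: eq[OF that(2)] mult.commute)
  show T': "matop R c x = T x" if "x \<in> L" for x
  proof
    fix i
    show "matop R c x i = T x i"
      using sums_unique[OF sums[OF that], of i] L_outside[OF op_L[OF T that], of i]
      by (cases "i \<in> R") (simp_all add: matop_def)
  qed
  have "summable (\<lambda>j. if j \<in> R then cmod (complex_of_real (c i j) * x j) else 0)" if "x \<in> L" "i \<in> R" for x i
  proof -
    \<comment> \<open>At |x| all terms are nonnegative reals, so convergence there is absolute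
      convergence at \<open>x\<close>.\<close>
    have "(\<lambda>j. Re (if j \<in> R then complex_of_real (c i j) * cabs x j else 0)) sums Re (T (cabs x) i)"
      using sums[OF cabs_L(1)[OF that(1)] that(2)] unfolding sums_complex_iff by blast
    then show ?thesis
      by (rule summable_cong[THEN iffD1, rotated, OF sums_summable]) (simp add: norm_mult c[OF that(2)])
  qed
  then show "pos_matrix c"
    unfolding pos_matrix_def defines_operator_def using c T' op_L[OF T] by auto
qed

lemma matop_unitvec:
  assumes "i \<in> R" "j \<in> R"
  shows "matop R a (unitvec j) i = complex_of_real (a i j)"
proof -
  have "(\<Sum>l. if l \<in> R then complex_of_real (a i l) * unitvec j l else 0)
      = (\<Sum>l\<in>{j}. if l \<in> R then complex_of_real (a i l) * unitvec j l else 0)"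
    by (rule suminf_finite) (auto simp: unitvec_def)
  then show ?thesis
    using assms by (simp add: matop_def) (simp add: unitvec_def)
qed

text \<open>An entry of the product is a coordinate of the operator of \<open>a\<close> applied to
  column \<open>j\<close> of \<open>b\<close>. That column lies in \<open>L\<close>, which is why
  the series behind \<open>matmul\<close> converges.\<close>

lemma matmul_sums:
  assumes a: "pos_matrix a" and b: "pos_matrix b" and i: "i \<in> R" and j: "j \<in> R"
  shows "(\<lambda>l. if l \<in> R then a i l * b l j else 0) sums matmul R a b i j"
    and "matop R a (matop R b (unitvec j)) i = complex_of_real (matmul R a b i j)"
proof -
  let ?y = "matop R b (unitvec j)"
  have y: "?y \<in> L"
    using matop_L[OF pos_matrix_op[OF b]] unitvec_L(1)[OF j] .
  have s: "(\<lambda>l. if l \<in> R then complex_of_real (a i l) * ?y l else 0) sums matop R a ?y i"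
    by (rule matop_sums[OF pos_matrix_op[OF a] y i])
  have trm: "(if l \<in> R then complex_of_real (a i l) * ?y l else 0) = complex_of_real (if l \<in> R then a i l * b l j else 0)" for l
    using matop_unitvec[OF _ j] by simp
  have re: "(\<lambda>l. if l \<in> R then a i l * b l j else 0) sums Re (matop R a ?y i)"
    and im: "(\<lambda>l. 0) sums Im (matop R a ?y i)"
    using s unfolding trm sums_complex_iff by simp_all
  have m: "matmul R a b i j = Re (matop R a ?y i)"
    using sums_unique[OF re] i j by (simp add: matmul_def)
  then show "(\<lambda>l. if l \<in> R then a i l * b l j else 0) sums matmul R a b i j"
    using re by simp
  show "matop R a ?y i = complex_of_real (matmul R a b i j)"
    using sums_unique2[OF im sums_zero] m by (simp add: complex_eq_iff)
qed

lemma matmul_nonneg: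
  assumes a: "pos_matrix a" and b: "pos_matrix b" and i: "i \<in> R" and j: "j \<in> R"
  shows "0 \<le> matmul R a b i j"
  by (rule sums_le[OF _ sums_zero matmul_sums(1)[OF assms]])
    (simp add: pos_matrix_nonneg[OF a i] pos_matrix_nonneg[OF b _ j])

lemma
  assumes a: "pos_matrix a" and b: "pos_matrix b"
  shows pos_matrix_matmul: "pos_matrix (matmul R a b)"
    and matop_matmul: "x \<in> L \<Longrightarrow> matop R (matmul R a b) x = matop R a (matop R b x)"
proof -
  have T: "bounded_op L nL (matop R a \<circ> matop R b)"
    using bounded_matop[OF a] bounded_matop[OF b] by simp
  have eq: "(matop R a \<circ> matop R b) (unitvec j) i = complex_of_real (matmul R a b i j)" if "i \<in> R" "j \<in> R" for i j
    using matmul_sums(2)[OF a b that] by simp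
  show "pos_matrix (matmul R a b)"
    by (rule pos_matrix_of_op(1)[OF T matmul_nonneg[OF a b] eq])
  show "x \<in> L \<Longrightarrow> matop R (matmul R a b) x = matop R a (matop R b x)"
    using pos_matrix_of_op(2)[OF T matmul_nonneg[OF a b] eq] by simp
qed

lemma matmul_mono:
  assumes a: "pos_matrix a" "pos_matrix a'" "\<And>i j. i \<in> R \<Longrightarrow> j \<in> R \<Longrightarrow> a i j \<le> a' i j" and b: "pos_matrix b"
    and i: "i \<in> R" and j: "j \<in> R"
  shows "matmul R a b i j \<le> matmul R a' b i j"
proof (rule sums_le[OF _ matmul_sums(1)[OF a(1) b i j] matmul_sums(1)[OF a(2) b i j]])
  fix l
  show "(if l \<in> R then a i l * b l j else 0) \<le> (if l \<in> R then a' i l * b l j else 0)"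
    using a(3)[OF i] pos_matrix_nonneg[OF b _ j] by (auto intro: mult_right_mono)
qed

lemma
  shows pos_matrix_idmat: "pos_matrix (idmat R)"
    and matop_idmat: "x \<in> L \<Longrightarrow> matop R (idmat R) x = x"
  using pos_matrix_of_op[of id "idmat R"] by (auto simp: idmat_def unitvec_def)

lemma pos_matrix_matprods:
  "(\<And>i. i \<in> {1..k} \<Longrightarrow> pos_matrix (F i)) \<Longrightarrow> pos_matrix (matprods R F k)"
  by (induction k) (simp_all add: pos_matrix_idmat pos_matrix_matmul)

lemma matop_matprods_const:
  assumes a: "pos_matrix a" and x: "x \<in> L"
  shows "matop R (matprods R (\<lambda>i. a) n) x = (matop R a ^^ n) x"
  using x
proof (induction n arbitrary: x)
  case (Suc n)
  then have "matop R (matprods R (\<lambda>i. a) n) (matop R a x) = (matop R a ^^ n) (matop R a x)"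
    using matop_L[OF pos_matrix_op[OF a]] by blast
  then show ?case
    using matop_matmul[OF pos_matrix_matprods a Suc.prems, of n "\<lambda>i. a"] a by (simp add: funpow_swap1)
qed (simp add: matop_idmat)

lemma pos_matrix_mono:
  assumes b: "pos_matrix b" and a: "\<And>i j. i \<in> R \<Longrightarrow> j \<in> R \<Longrightarrow> 0 \<le> a i j"
    and ab: "\<And>i j. i \<in> R \<Longrightarrow> j \<in> R \<Longrightarrow> a i j \<le> b i j"
  shows "pos_matrix a"
proof -
  note op = pos_matrix_op[OF b]
  have "matop R a x \<in> L" if "x \<in> L" for x
  proof (rule solid(1)[OF matop_L[OF op cabs_L(1)[OF that]]])
    show "cmod (matop R a x i) \<le> cmod (matop R b (cabs x) i)" for i
    proof (cases "i \<in> R")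
      case True
      then show ?thesis
        using a ab by (intro matop_dominated[OF op that]) simp_all
    qed (simp add: matop_outside)
  qed
  moreover have "summable (\<lambda>j. if j \<in> R then cmod (complex_of_real (a i j) * x j) else 0)" if "x \<in> L" "i \<in> R" for x i
    using a[OF that(2)] ab[OF that(2)]
    by (intro summable_cong[THEN iffD1, rotated, OF matop_dominated_summable[where a = a and b = b and i = i, OF op that(1) _ order_refl that(2)]]) simp_all
  ultimately show ?thesis
    unfolding pos_matrix_def defines_operator_def using a by blast
qed

lemma
  assumes J: "finite J" and w: "\<And>j. j \<in> J \<Longrightarrow> 0 \<le> w j" and a: "\<And>j. j \<in> J \<Longrightarrow> pos_matrix (a j)"
  shows pos_matrix_sum: "pos_matrix (\<lambda>i l. \<Sum>j\<in>J. w j * a j i l)"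
    and matop_sum: "x \<in> L \<Longrightarrow> matop R (\<lambda>i l. \<Sum>j\<in>J. w j * a j i l) x = (\<Sum>j\<in>J. smul (of_real (w j)) (matop R (a j) x))"
proof -
  let ?T = "\<Sum>j\<in>J. (smul (of_real (w j)) \<circ> matop R (a j))"
  have T: "bounded_op L nL ?T"
    using bounded_matop[OF a] by (intro bounded_sum bounded_comp bounded_smul)
  have nonneg: "0 \<le> (\<Sum>j\<in>J. w j * a j i l)" if "i \<in> R" "l \<in> R" for i l
    using w pos_matrix_nonneg[OF a that] by (intro sum_nonneg mult_nonneg_nonneg) auto
  have eq: "?T (unitvec l) i = complex_of_real (\<Sum>j\<in>J. w j * a j i l)" if "i \<in> R" "l \<in> R" for i l
    by (simp add: sum_apply matop_unitvec[OF that])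
  show "pos_matrix (\<lambda>i l. \<Sum>j\<in>J. w j * a j i l)"
    by (rule pos_matrix_of_op(1)[OF T nonneg eq])
  show "matop R (\<lambda>i l. \<Sum>j\<in>J. w j * a j i l) x = (\<Sum>j\<in>J. smul (of_real (w j)) (matop R (a j) x))" if "x \<in> L"
    using pos_matrix_of_op(2)[OF T nonneg eq that] unfolding sum_apply comp_apply .
qed

text \<open>An entry is a coordinate of a column, and a column is the image of a unit vector of norm
  1.\<close>

lemma entry_le:
  assumes tail: "\<And>x. x \<in> L \<Longrightarrow> nL (tail n (matop R a x)) \<le> N * nL x" and a: "pos_matrix a"
    and i: "i \<in> R" "n \<le> i" and l: "l \<in> R"
  shows "a i l \<le> N"
proof -
  note u = unitvec_L[OF l]
  have "a i l = cmod (tail n (matop R a (unitvec l)) i)"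
    using matop_unitvec[OF i(1) l] i pos_matrix_nonneg[OF a i(1) l] by (simp add: tail_def)
  also have "\<dots> \<le> nL (tail n (matop R a (unitvec l)))"
    by (rule coord_le[OF tail_L[OF matop_L[OF pos_matrix_op[OF a] u(1)]]])
  also have "\<dots> \<le> N"
    using tail[OF u(1)] u(2) by simp
  finally show ?thesis .
qed

end

section \<open>Hadamard weighted products\<close>

lemma tendsto_prod_powr:
  fixes c \<alpha> :: "'a \<Rightarrow> real"
  assumes "\<And>j. j \<in> J \<Longrightarrow> 0 \<le> c j" "\<And>j. j \<in> J \<Longrightarrow> 0 < \<alpha> j"
  shows "((\<lambda>e. \<Prod>j\<in>J. (c j + e) powr \<alpha> j) \<longlongrightarrow> (\<Prod>j\<in>J. c j powr \<alpha> j)) (at_right 0)"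
proof (rule tendsto_prod)
  fix j assume j: "j \<in> J"
  show "((\<lambda>e. (c j + e) powr \<alpha> j) \<longlongrightarrow> c j powr \<alpha> j) (at_right 0)"
  proof (rule tendsto_powr')
    show "((\<lambda>e. c j + e) \<longlongrightarrow> c j) (at_right 0)"
      by (auto intro!: tendsto_eq_intros)
    \<comment> \<open>At a zero base \<open>powr\<close> is continuous from the right because the
      exponent is positive.\<close>
    show "c j \<noteq> 0 \<or> 0 < \<alpha> j \<and> (\<forall>\<^sub>F e in at_right 0. 0 \<le> c j + e)"
      using assms j by (auto simp: eventually_at_right_field intro!: exI[of _ 1])
  qed simp
qed

context seq_space
begin

abbreviation hadamard :: "nat \<Rightarrow> (nat \<Rightarrow> real) \<Rightarrow> (nat \<Rightarrow> rmat) \<Rightarrow> rmat" where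
  "hadamard m \<alpha> a \<equiv> hprods (\<lambda>j. hpow (a j) (\<alpha> j)) m"

lemma hadamard_apply: "hadamard m \<alpha> a i l = (\<Prod>j\<in>{1..m}. a j i l powr \<alpha> j)"
  by (simp add: hprods_def hpow_def)

lemma hadamard_nonneg: "0 \<le> hadamard m \<alpha> a i l"
  by (simp add: hadamard_apply prod_nonneg)

context
  fixes m :: nat and \<alpha> :: "nat \<Rightarrow> real"
  assumes \<alpha>_pos: "\<And>j. j \<in> {1..m} \<Longrightarrow> 0 < \<alpha> j" and \<alpha>_sum: "1 \<le> sum \<alpha> {1..m}"
begin

text \<open>In rows from \<open>n\<close> on the entries are bounded by \<open>N\<close>, so the
  linear majorant \<open>?D\<close> dominates the Hadamard product there; earlier rows are removed
  by \<open>tail n\<close>. For \<open>n = 0\<close> all rows are dominated, which shows that the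
  Hadamard product defines an operator in the first place.\<close>

lemma
  assumes a: "\<And>j. j \<in> {1..m} \<Longrightarrow> pos_matrix (a j)" and N: "\<And>j. j \<in> {1..m} \<Longrightarrow> 0 < N j"
    and tail: "\<And>j x. j \<in> {1..m} \<Longrightarrow> x \<in> L \<Longrightarrow> nL (tail n (matop R (a j) x)) \<le> N j * nL x"
  shows hadamard_tail: "x \<in> L \<Longrightarrow> nL (tail n (matop R (hadamard m \<alpha> a) x)) \<le> (\<Prod>j\<in>{1..m}. N j powr \<alpha> j) * nL x"
    and pos_matrix_hadamard_aux: "n = 0 \<Longrightarrow> pos_matrix (hadamard m \<alpha> a)"
proof -
  define P where "P = (\<Prod>j\<in>{1..m}. N j powr \<alpha> j)"
  define w where "w j = P * (\<alpha> j / sum \<alpha> {1..m}) / N j" for j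
  have P: "P \<ge> 0"
    by (simp add: P_def prod_nonneg)
  have w: "w j \<ge> 0" if "j \<in> {1..m}" for j
    using P \<alpha>_pos[OF that] \<alpha>_sum N[OF that] by (simp add: w_def)
  let ?D = "\<lambda>i l. \<Sum>j\<in>{1..m}. w j * a j i l"
  have D: "pos_matrix ?D"
    using w a by (intro pos_matrix_sum) auto
  have le: "hadamard m \<alpha> a i l \<le> ?D i l" if "i \<in> R" "n \<le> i" "l \<in> R" for i l
    unfolding hadamard_apply w_def P_def
    using N \<alpha>_pos \<alpha>_sum pos_matrix_nonneg[OF a that(1,3)] entry_le[OF tail a that]
    by (intro prod_powr_le_weighted_sum) auto
  show "nL (tail n (matop R (hadamard m \<alpha> a) x)) \<le> (\<Prod>j\<in>{1..m}. N j powr \<alpha> j) * nL x" if x: "x \<in> L"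
  proof -
    have Dx: "tail n (matop R ?D (cabs x)) = (\<Sum>j\<in>{1..m}. smul (of_real (w j)) (tail n (matop R (a j) (cabs x))))"
      using matop_sum[where J = "{1..m}" and w = w and a = a, OF _ w a cabs_L(1)[OF x]]
      by (simp add: tail_def fun_eq_iff sum_apply)
    have aL: "tail n (matop R (a j) (cabs x)) \<in> L" if "j \<in> {1..m}" for j
      using matop_L[OF pos_matrix_op[OF a[OF that]] cabs_L(1)[OF x]] by simp
    have "nL (tail n (matop R (hadamard m \<alpha> a) x)) \<le> nL (tail n (matop R ?D (cabs x)))"
    proof (rule solid(2)[OF tail_L[OF matop_L[OF pos_matrix_op[OF D] cabs_L(1)[OF x]]]])
      fix i
      have "cmod (matop R (hadamard m \<alpha> a) x i) \<le> cmod (matop R ?D (cabs x) i)" if "n \<le> i"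
      proof (cases "i \<in> R")
        case True
        show ?thesis
          by (rule matop_dominated[OF pos_matrix_op[OF D] x _ order_refl])
            (use le[OF True that] hadamard_nonneg in simp)
      qed (simp add: matop_outside)
      then show "cmod (tail n (matop R (hadamard m \<alpha> a) x) i) \<le> cmod (tail n (matop R ?D (cabs x)) i)"
        by (simp add: tail_def)
    qed
    also have "\<dots> \<le> (\<Sum>j\<in>{1..m}. nL (smul (of_real (w j)) (tail n (matop R (a j) (cabs x)))))"
      unfolding Dx by (intro norm_sum L_smul aL)
    also have "\<dots> \<le> (\<Sum>j\<in>{1..m}. w j * N j * nL x)"
    proof (rule sum_mono)
      fix j assume j: "j \<in> {1..m}"
      have "nL (smul (of_real (w j)) (tail n (matop R (a j) (cabs x)))) = w j * nL (tail n (matop R (a j) (cabs x)))"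
        using aL[OF j] w[OF j] by simp
      also have "\<dots> \<le> w j * (N j * nL x)"
        using tail[OF j cabs_L(1)[OF x]] w[OF j] x by (intro mult_left_mono) simp_all
      finally show "nL (smul (of_real (w j)) (tail n (matop R (a j) (cabs x)))) \<le> w j * N j * nL x"
        by simp
    qed
    also have "\<dots> = (\<Sum>j\<in>{1..m}. w j * N j) * nL x"
      by (simp add: sum_distrib_right)
    also have "(\<Sum>j\<in>{1..m}. w j * N j) = P"
      unfolding w_def using N \<alpha>_sum by (intro sum_weights) (auto simp: less_imp_neq[symmetric])
    finally show ?thesis by (simp only: P_def)
  qed
  show "pos_matrix (hadamard m \<alpha> a)" if "n = 0"
    by (rule pos_matrix_mono[OF D hadamard_nonneg]) (use le that in auto)
qed

lemma pos_matrix_hadamard: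
  assumes a: "\<And>j. j \<in> {1..m} \<Longrightarrow> pos_matrix (a j)"
  shows "pos_matrix (hadamard m \<alpha> a)"
proof -
  have "\<exists>K. K > 0 \<and> (\<forall>x\<in>L. nL (matop R (a j) x) \<le> K * nL x)" if "j \<in> {1..m}" for j
    using op_bound[OF bounded_matop[OF a[OF that]]] by metis
  then obtain N where N: "\<And>j. j \<in> {1..m} \<Longrightarrow> N j > 0"
    "\<And>j x. j \<in> {1..m} \<Longrightarrow> x \<in> L \<Longrightarrow> nL (matop R (a j) x) \<le> N j * nL x"
    by metis
  have "tail 0 x = x" for x
    by (simp add: tail_def)
  then show ?thesis
    using pos_matrix_hadamard_aux[of a N 0] a N by simp
qed

lemma mnc_hadamard_less:
  assumes a: "\<And>j. j \<in> {1..m} \<Longrightarrow> pos_matrix (a j)" and N: "\<And>j. j \<in> {1..m} \<Longrightarrow> mnc (matop R (a j)) < N j"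
  shows "mnc (matop R (hadamard m \<alpha> a)) \<le> (\<Prod>j\<in>{1..m}. N j powr \<alpha> j)"
proof -
  have N0: "0 < N j" if "j \<in> {1..m}" for j
    using N[OF that] mnc_nonneg[OF bounded_matop[OF a[OF that]]] by simp
  have "\<exists>n. \<forall>x\<in>L. nL (tail n (matop R (a j) x)) \<le> N j * nL x" if "j \<in> {1..m}" for j
    by (rule mnc_tail[OF bounded_matop[OF a[OF that]] N[OF that]])
  then obtain n where n: "\<And>j x. j \<in> {1..m} \<Longrightarrow> x \<in> L \<Longrightarrow> nL (tail (n j) (matop R (a j) x)) \<le> N j * nL x"
    by metis
  \<comment> \<open>A common cut-off for all factors; enlarging a cut-off is harmless since tails
    decrease in norm.\<close>
  define k where "k = Max (insert 0 (n ` {1..m}))"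
  have k: "nL (tail k (matop R (a j) x)) \<le> N j * nL x" if "j \<in> {1..m}" "x \<in> L" for j x
  proof -
    have "n j \<le> k"
      unfolding k_def using that(1) by (intro Max_ge) auto
    then show ?thesis
      using order.trans[OF tail_mono n[OF that]] matop_L[OF pos_matrix_op[OF a[OF that(1)]] that(2)] by simp
  qed
  show ?thesis
    by (rule mnc_le_tail[OF bounded_matop[OF pos_matrix_hadamard[OF a]] hadamard_tail[OF a N0 k]])
      (auto simp: prod_nonneg)
qed

text \<open>Truncated norms are only bounded by positive numbers strictly above \<gamma>, and
  \<gamma> may be 0. Hence the bound with \<gamma> + e and a limit from the right.\<close>

lemma mnc_hadamard:
  assumes a: "\<And>j. j \<in> {1..m} \<Longrightarrow> pos_matrix (a j)"
  shows "mnc (matop R (hadamard m \<alpha> a)) \<le> (\<Prod>j\<in>{1..m}. mnc (matop R (a j)) powr \<alpha> j)"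
proof (rule tendsto_lowerbound)
  show "((\<lambda>e. \<Prod>j\<in>{1..m}. (mnc (matop R (a j)) + e) powr \<alpha> j) \<longlongrightarrow> (\<Prod>j\<in>{1..m}. mnc (matop R (a j)) powr \<alpha> j)) (at_right 0)"
    using mnc_nonneg[OF bounded_matop[OF a]] \<alpha>_pos by (rule tendsto_prod_powr)
  have "mnc (matop R (hadamard m \<alpha> a)) \<le> (\<Prod>j\<in>{1..m}. (mnc (matop R (a j)) + e) powr \<alpha> j)" if "e > 0" for e
    using that by (intro mnc_hadamard_less a) auto
  then show "\<forall>\<^sub>F e in at_right 0. mnc (matop R (hadamard m \<alpha> a)) \<le> (\<Prod>j\<in>{1..m}. (mnc (matop R (a j)) + e) powr \<alpha> j)"
    by (auto simp: eventually_at_right_field intro: exI[of _ 1])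
qed simp

text \<open>Hoelder's inequality for the series over the inner index.\<close>

lemma matmul_hadamard_le:
  assumes a: "\<And>j. j \<in> {1..m} \<Longrightarrow> pos_matrix (a j)" and b: "\<And>j. j \<in> {1..m} \<Longrightarrow> pos_matrix (b j)"
    and i: "i \<in> R" and h: "h \<in> R"
  shows "matmul R (hadamard m \<alpha> a) (hadamard m \<alpha> b) i h \<le> hadamard m \<alpha> (\<lambda>j. matmul R (a j) (b j)) i h"
proof -
  \<comment> \<open>An index outside \<open>R\<close> contributes 0 on the left; the product of
    powers agrees with this because it is not empty.\<close>
  have m: "{1..m} \<noteq> {}"
    using \<alpha>_sum by (cases m) auto
  let ?c = "\<lambda>j l. if l \<in> R then a j i l * b j l h else 0"
  have eq: "(if l \<in> R then hadamard m \<alpha> a i l * hadamard m \<alpha> b l h else 0) = (\<Prod>j\<in>{1..m}. ?c j l powr \<alpha> j)" for l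
  proof (cases "l \<in> R")
    case True
    have "(\<Prod>j\<in>{1..m}. ?c j l powr \<alpha> j) = (\<Prod>j\<in>{1..m}. a j i l powr \<alpha> j * b j l h powr \<alpha> j)"
      using True pos_matrix_nonneg[OF a i True] pos_matrix_nonneg[OF b True h] by (intro prod.cong) (auto simp: powr_mult)
    then show ?thesis
      using True by (simp add: hadamard_apply prod.distrib)
  next
    case False
    then show ?thesis using m by (simp add: prod_zero_iff)
  qed
  have "(\<Sum>l. \<Prod>j\<in>{1..m}. ?c j l powr \<alpha> j) \<le> (\<Prod>j\<in>{1..m}. matmul R (a j) (b j) i h powr \<alpha> j)"
    by (rule holder_sums(2)[OF _ _ matmul_sums(1)[OF a b i h] \<alpha>_pos \<alpha>_sum])
      (simp_all add: pos_matrix_nonneg[OF a i] pos_matrix_nonneg[OF b _ h])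
  then show ?thesis
    using i h by (simp add: matmul_def[of R "hadamard m \<alpha> a"] eq hadamard_apply[where a = "\<lambda>j. matmul R (a j) (b j)"])
qed

text \<open>Induction that splits off the last factor: monotonicity replaces the left part by its
  bound, then the inequality for two factors applies.\<close>

lemma matprods_hadamard_le:
  assumes F: "\<And>q j. q \<in> {1..k} \<Longrightarrow> j \<in> {1..m} \<Longrightarrow> pos_matrix (F q j)" and i: "i \<in> R" and h: "h \<in> R"
  shows "matprods R (\<lambda>q. hadamard m \<alpha> (F q)) k i h \<le> hadamard m \<alpha> (\<lambda>j. matprods R (\<lambda>q. F q j) k) i h"
  using F i h
proof (induction k arbitrary: i h)
  case 0
  then show ?case
    by (cases "i = h") (simp_all add: hadamard_apply idmat_def prod_nonneg)
next
  case (Suc k)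
  let ?A = "matprods R (\<lambda>q. hadamard m \<alpha> (F q)) k" and ?B = "\<lambda>j. matprods R (\<lambda>q. F q j) k"
  have B: "pos_matrix (?B j)" if "j \<in> {1..m}" for j
    using Suc.prems(1) that by (intro pos_matrix_matprods) simp
  have H: "pos_matrix (hadamard m \<alpha> (F q))" if "q \<in> {1..Suc k}" for q
    using Suc.prems(1)[OF that] by (rule pos_matrix_hadamard)
  have "matmul R ?A (hadamard m \<alpha> (F (Suc k))) i h \<le> matmul R (hadamard m \<alpha> ?B) (hadamard m \<alpha> (F (Suc k))) i h"
  proof (rule matmul_mono)
    show "?A i l \<le> hadamard m \<alpha> ?B i l" if "i \<in> R" "l \<in> R" for i l
      using Suc.prems(1) that by (intro Suc.IH) simp_all
  qed (use B H Suc.prems in \<open>auto intro!: pos_matrix_matprods pos_matrix_hadamard\<close>)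
  also have "\<dots> \<le> hadamard m \<alpha> (\<lambda>j. matmul R (?B j) (F (Suc k) j)) i h"
    using B Suc.prems by (intro matmul_hadamard_le) auto
  finally show ?case by simp
qed

end

text \<open>Powers inherit the domination, so one exponent that certifies a bound for
  \<open>b\<close> through \<gamma> certifies it for \<open>a\<close>.\<close>

lemma ess_rad_mono:
  assumes a: "pos_matrix a" and b: "pos_matrix b" and ab: "\<And>i j. i \<in> R \<Longrightarrow> j \<in> R \<Longrightarrow> a i j \<le> b i j"
  shows "ess_rad L nL (matop R a) \<le> ess_rad L nL (matop R b)"
proof (rule dense_ge)
  fix s assume s: "ess_rad L nL (matop R b) < s"
  obtain N where N: "N \<ge> 1" "mnc (matop R b ^^ N) \<le> s ^ N"
    using ess_rad_mnc[OF positive_matop[OF b] s] by blast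
  have dom: "cmod ((matop R a ^^ n) x i) \<le> cmod ((matop R b ^^ n) (cabs x) i)" if x: "x \<in> L" for n x i
  proof (induction n arbitrary: i)
    case (Suc n)
    note T = positive_funpow[OF positive_matop[OF b], of n]
    have y: "(matop R b ^^ n) (cabs x) \<in> L" "seq_pos ((matop R b ^^ n) (cabs x))"
      using op_L[OF positive_bounded[OF T] cabs_L(1)[OF x]] positive_pos[OF T cabs_L(1)[OF x]] by simp_all
    show ?case
    proof (cases "i \<in> R")
      case True
      have "cmod (matop R a ((matop R a ^^ n) x) i) \<le> cmod (matop R b (cabs ((matop R b ^^ n) (cabs x))) i)"
        using pos_matrix_nonneg[OF a True] ab[OF True]
        by (intro matop_dominated[OF pos_matrix_op[OF b] y(1) _ Suc.IH]) simp
      then show ?thesis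
        by (simp only: funpow.simps comp_apply cabs_pos[OF y(2)])
    qed (simp add: matop_outside)
  qed simp
  have "mnc (matop R a ^^ N) \<le> mnc (matop R b ^^ N)"
    by (rule mnc_dominated[OF bounded_funpow[OF bounded_matop[OF a]] bounded_funpow[OF bounded_matop[OF b]] dom])
  then show "ess_rad L nL (matop R a) \<le> s"
    using N s ess_rad_ge(1)[OF bounded_matop[OF b]] by (intro ess_rad_le[OF bounded_matop[OF a] N(1)]) linarith+
qed

lemma mnc_mono:
  assumes a: "pos_matrix a" and b: "pos_matrix b" and ab: "\<And>i j. i \<in> R \<Longrightarrow> j \<in> R \<Longrightarrow> a i j \<le> b i j"
  shows "mnc (matop R a) \<le> mnc (matop R b)"
proof (rule mnc_dominated[OF bounded_matop[OF a] bounded_matop[OF b]])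
  fix x i assume x: "x \<in> L"
  show "cmod (matop R a x i) \<le> cmod (matop R b (cabs x) i)"
  proof (cases "i \<in> R")
    case True
    then show ?thesis
      using pos_matrix_nonneg[OF a True] ab[OF True] by (intro matop_dominated[OF pos_matrix_op[OF b] x]) simp_all
  qed (simp add: matop_outside)
qed

lemma ess_rad_hadamard:
  assumes \<alpha>: "\<And>j. j \<in> {1..m} \<Longrightarrow> 0 < \<alpha> j" "1 \<le> sum \<alpha> {1..m}" and a: "\<And>j. j \<in> {1..m} \<Longrightarrow> pos_matrix (a j)"
  shows "ess_rad L nL (matop R (hadamard m \<alpha> a)) \<le> (\<Prod>j\<in>{1..m}. ess_rad L nL (matop R (a j)) powr \<alpha> j)"
proof (rule tendsto_lowerbound)
  let ?r = "\<lambda>j. ess_rad L nL (matop R (a j))" and ?C = "hadamard m \<alpha> a"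
  have r: "0 \<le> ?r j" if "j \<in> {1..m}" for j
    by (rule ess_rad_ge(1)[OF bounded_matop[OF a[OF that]]])
  have C: "pos_matrix ?C"
    by (rule pos_matrix_hadamard[OF \<alpha> a])
  show "((\<lambda>e. \<Prod>j\<in>{1..m}. (?r j + e) powr \<alpha> j) \<longlongrightarrow> (\<Prod>j\<in>{1..m}. ?r j powr \<alpha> j)) (at_right 0)"
    using r \<alpha>(1) by (rule tendsto_prod_powr)
  have "ess_rad L nL (matop R ?C) \<le> (\<Prod>j\<in>{1..m}. (?r j + e) powr \<alpha> j)" if e: "e > 0" for e
  proof -
    have "\<exists>N\<ge>1. mnc (matop R (a j) ^^ N) \<le> (?r j + e) ^ N" if "j \<in> {1..m}" for j
      using e by (intro ess_rad_mnc[OF positive_matop[OF a[OF that]]]) simp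
    then obtain n where n: "\<And>j. j \<in> {1..m} \<Longrightarrow> n j \<ge> 1"
      "\<And>j. j \<in> {1..m} \<Longrightarrow> mnc (matop R (a j) ^^ n j) \<le> (?r j + e) ^ n j"
      by metis
    \<comment> \<open>A common multiple of the exponents \<open>n j\<close>, so that one power works
      for all factors.\<close>
    define N where "N = (\<Prod>j\<in>{1..m}. n j)"
    have N1: "N \<ge> 1"
      unfolding N_def using n(1) by (simp add: Suc_le_eq prod_pos)
    have N: "mnc (matop R (a j) ^^ N) \<le> (?r j + e) ^ N" if "j \<in> {1..m}" for j
    proof -
      have "n j dvd N"
        unfolding N_def using that by (intro dvd_prodI) auto
      then obtain q where "N = n j * q" ..
      then show ?thesis
        using mnc_funpow_mult[OF bounded_matop[OF a[OF that]] n(2)[OF that]] r[OF that] e by simp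
    qed
    let ?B = "\<lambda>j. matprods R (\<lambda>q. a j) N"
    have B: "pos_matrix (?B j)" if "j \<in> {1..m}" for j
      using a[OF that] by (rule pos_matrix_matprods)
    have "mnc (matop R ?C ^^ N) = mnc (matop R (matprods R (\<lambda>q. ?C) N))"
      by (rule mnc_cong) (simp add: matop_matprods_const[OF C])
    \<comment> \<open>Here the inequality for products is used with N equal factors in each
      column.\<close>
    also have "\<dots> \<le> mnc (matop R (hadamard m \<alpha> ?B))"
      using a by (intro mnc_mono pos_matrix_matprods C pos_matrix_hadamard[OF \<alpha>] B matprods_hadamard_le[OF \<alpha>])
    also have "\<dots> \<le> (\<Prod>j\<in>{1..m}. mnc (matop R (?B j)) powr \<alpha> j)"
      by (rule mnc_hadamard[OF \<alpha> B])
    also have "\<dots> \<le> (\<Prod>j\<in>{1..m}. ((?r j + e) ^ N) powr \<alpha> j)"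
    proof (rule prod_mono, rule conjI)
      fix j assume j: "j \<in> {1..m}"
      have "mnc (matop R (?B j)) = mnc (matop R (a j) ^^ N)"
        by (rule mnc_cong) (simp add: matop_matprods_const[OF a[OF j]])
      then show "mnc (matop R (?B j)) powr \<alpha> j \<le> ((?r j + e) ^ N) powr \<alpha> j"
        using N[OF j] \<alpha>(1)[OF j] mnc_nonneg[OF bounded_matop[OF B[OF j]]] by (intro powr_mono2) auto
    qed simp
    also have "\<dots> = (\<Prod>j\<in>{1..m}. (?r j + e) powr \<alpha> j) ^ N"
      unfolding prod_power_distrib
    proof (rule prod.cong)
      fix j assume "j \<in> {1..m}"
      then have "?r j + e > 0"
        using r e by (simp add: add_nonneg_pos)
      then show "((?r j + e) ^ N) powr \<alpha> j = ((?r j + e) powr \<alpha> j) ^ N"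
        by (simp add: powr_powr mult.commute flip: powr_realpow)
    qed simp
    finally show ?thesis
      by (rule ess_rad_le[OF bounded_matop[OF C] N1]) (simp add: prod_nonneg)
  qed
  then show "\<forall>\<^sub>F e in at_right 0. ess_rad L nL (matop R ?C) \<le> (\<Prod>j\<in>{1..m}. (?r j + e) powr \<alpha> j)"
    by (auto simp: eventually_at_right_field intro: exI[of _ 1])
qed simp

end

theorem theorem3p5:
  fixes R :: "nat set" and L :: "cseq set" and nL :: "cseq \<Rightarrow> real"
    and k m :: nat and Am :: "nat \<Rightarrow> nat \<Rightarrow> rmat" and alpha :: "nat \<Rightarrow> real"
  assumes L: "in_class_L R L nL"
    and ocL: "order_cont_norm L seq_pos nL seq_sub (\<lambda>n. 0)"
    and ocLd: "order_cont_norm (Ldual L nL) (dual_pos L) (dual_norm L nL) dual_sub (\<lambda>x. 0)"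
    and k: "k \<ge> 1" and m: "m \<ge> 1"
    and nonneg: "\<forall>i\<in>{1..k}. \<forall>j\<in>{1..m}. \<forall>r\<in>R. \<forall>s\<in>R. 0 \<le> Am i j r s"
    and ops: "\<forall>i\<in>{1..k}. \<forall>j\<in>{1..m}. defines_operator R L (Am i j)"
    and apos: "\<forall>j\<in>{1..m}. 0 < alpha j"
    and asum: "(\<Sum>j=1..m. alpha j) \<ge> 1"
  shows
   "let A = matprods R (\<lambda>i. hprods (\<lambda>j. hpow (Am i j) (alpha j)) m) k;
        B = (\<lambda>j. matprods R (\<lambda>i. Am i j) k);
        C = hprods (\<lambda>j. hpow (B j) (alpha j)) m
    in hmnc L nL (matop R A) \<le> hmnc L nL (matop R C) \<and>
       hmnc L nL (matop R C) \<le> (\<Prod>j=1..m. hmnc L nL (matop R (B j)) powr alpha j) \<and>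
       ess_rad L nL (matop R A) \<le> ess_rad L nL (matop R C) \<and>
       ess_rad L nL (matop R C) \<le> (\<Prod>j=1..m. ess_rad L nL (matop R (B j)) powr alpha j)"
proof -
  interpret seq_space R L nL
    using L ocL by unfold_locales
  have F: "pos_matrix (Am i j)" if "i \<in> {1..k}" "j \<in> {1..m}" for i j
    using nonneg ops that by (simp add: pos_matrix_def)
  have \<alpha>: "0 < alpha j" if "j \<in> {1..m}" for j
    using apos that by blast
  let ?A = "matprods R (\<lambda>i. hadamard m alpha (Am i)) k" and ?B = "\<lambda>j. matprods R (\<lambda>i. Am i j) k"
  have B: "pos_matrix (?B j)" if "j \<in> {1..m}" for j
    using F that by (intro pos_matrix_matprods)
  have A: "pos_matrix ?A"
    using F by (intro pos_matrix_matprods pos_matrix_hadamard[OF \<alpha> asum])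
  have C: "pos_matrix (hadamard m alpha ?B)"
    by (rule pos_matrix_hadamard[OF \<alpha> asum B])
  have le: "?A i h \<le> hadamard m alpha ?B i h" if "i \<in> R" "h \<in> R" for i h
    by (rule matprods_hadamard_le[OF \<alpha> asum F that])
  show ?thesis
    unfolding Let_def
    by (intro conjI mnc_mono[OF A C le] ess_rad_mono[OF A C le]
        mnc_hadamard[where a = ?B, OF \<alpha> asum B] ess_rad_hadamard[where a = ?B, OF \<alpha> asum B])
qed

end
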